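(* Let $\mathcal{A} \subset \mathbb{Z}$ be a finite alphabet and let $\eta \in \mathcal{A}^{\mathbb{Z}^2}$ be a configuration with a non-trivial annihilator. If, for every line $\ell \subset \mathbb{R}^2$ through the origin, at least one of the two oriented lines $\pmb{\ell}$, $-\pmb{\ell}$ obtained by orienting $\ell$ is not in $\mathrm{ONED}(\eta)$, then $\eta$ is fully periodic.
   Context: The alphabet $\mathcal{A}$ is finite with at least two elements. A configuration is an element $\eta = (\eta_g)_{g\in\mathbb{Z}^2} \in \mathcal{A}^{\mathbb{Z}^2}$. For $u \in \mathbb{Z}^2$, the shift is $(T^u\eta)_g = \eta_{g+u}$. A non-zero $h \in \mathbb{Z}^2$ is a period of $\eta$ if $\eta_{g+h}=\eta_g$ for all $g \in \mathbb{Z}^2$; $\eta$ is periodic if it has a period and fully periodic if it has two periods that are linearly independent over $\mathbb{R}$. Annihilators: a Laurent polynomial $\varphi(X) = a_1X^{u_1}+\cdots+a_nX^{u_n}$ with $a_i \in \mathbb{Z}$, $u_i \in \mathbb{Z}^2$ (where $X^{(p,q)} = x_1^{p}x_2^{q}$) annihilates $\eta$ if $a_1\eta_{g-u_1}+\cdots+a_n\eta_{g-u_n}=0$ for all $g \in \mathbb{Z}^2$. "Non-trivial annihilator" means that some non-zero Laurent polynomial with integer coefficients annihilates $\eta$. Let $X_\eta = \overline{\{T^u\eta : u \in \mathbb{Z}^2\}}$ (closure in the product topology). For an oriented line $\pmb{\ell}$ through the origin, with non-zero vector $(u_1,u_2)$ giving its orientation, let $\mathcal{H}(\pmb{\ell})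 = \{g \in \mathbb{Z}^2 : \langle g,(-u_2,u_1)\rangle \ge 0\}$. The oriented line $\pmb{\ell}$ is a one-sided expansive direction on $X_\eta$ if for all $x,y \in X_\eta$, $x|_{\mathcal{H}(\pmb{\ell})} = y|_{\mathcal{H}(\pmb{\ell})}$ implies $x=y$; otherwise it is a one-sided nonexpansive direction on $X_\eta$. $\mathrm{ONED}(\eta)$ is the set of oriented lines through the origin that are one-sided nonexpansive directions on $X_\eta$. For a line $\ell$, $\pmb{\ell}$ denotes $\ell$ with a given orientation and $-\pmb{\ell}$ the same line with the opposite orientation. *)

theory Defs
  imports "HOL-Analysis.Analysis" "HOL-Library.Poly_Mapping"
begin

type_synonym config = "int \<times> int \<Rightarrow> int"

definition shift :: "int \<times> int \<Rightarrow> config \<Rightarrow> config" where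
  "shift u \<eta> = (\<lambda>g. \<eta> (g + u))"

definition real_vec :: "int \<times> int \<Rightarrow> real \<times> real" where
  "real_vec g = (real_of_int (fst g), real_of_int (snd g))"

definition is_period :: "config \<Rightarrow> int \<times> int \<Rightarrow> bool" where
  "is_period \<eta> h \<longleftrightarrow> h \<noteq> 0 \<and> (\<forall>g. \<eta> (g + h) = \<eta> g)"

text \<open>The condition \<open>h \<noteq> k\<close> is needed because \<^const>\<open>independent\<close> speaks about sets, and
  \<open>{v, v} = {v}\<close> is independent for non-zero \<open>v\<close>.\<close>

definition fully_periodic :: "config \<Rightarrow> bool" where
  "fully_periodic \<eta> \<longleftrightarrow>
    (\<exists>h k. is_period \<eta> h \<and> is_period \<eta> k \<and> h \<noteq> k \<and> independent {real_vec h, real_vec k})"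

text \<open>The finitely supported maps from \<open>\<int>\<^sup>2\<close> to \<open>\<int>\<close>, i.e. the group ring \<open>\<int>[\<int>\<^sup>2]\<close>, are the Laurent
  polynomials in two variables: the value at \<open>(p, q)\<close> is the coefficient of \<open>x\<^sub>1\<^sup>p x\<^sub>2\<^sup>q\<close>.\<close>

type_synonym laurent_poly2 = "(int \<times> int) \<Rightarrow>\<^sub>0 int"

definition annihilates :: "laurent_poly2 \<Rightarrow> config \<Rightarrow> bool" where
  "annihilates \<phi> \<eta> \<longleftrightarrow>
    (\<forall>g. (\<Sum>u\<in>Poly_Mapping.keys \<phi>. Poly_Mapping.lookup \<phi> u * \<eta> (g - u)) = 0)"

definition has_nontrivial_annihilator :: "config \<Rightarrow> bool" where
  "has_nontrivial_annihilator \<eta> \<longleftrightarrow> (\<exists>\<phi>. \<phi> \<noteq> 0 \<and> annihilates \<phi> \<eta>)"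

text \<open>The topology on \<^typ>\<open>config\<close> is the product of the discrete topologies. The closure may be
  taken in \<open>\<int>\<^sup>\<int>\<^sup>2\<close> rather than in \<open>A\<close>-valued configurations, because the latter form a closed subset;
  see \<open>orbit_closure_alphabet\<close>.\<close>

definition orbit_closure :: "config \<Rightarrow> config set" where
  "orbit_closure \<eta> = closure (range (\<lambda>u. shift u \<eta>))"

lemma orbit_closure_alphabet:
  assumes "range \<eta> \<subseteq> A" and "x \<in> orbit_closure \<eta>"
  shows "range x \<subseteq> A"
proof -
  have "open {y::config. y g \<in> B}" for g B
  proof -
    have "continuous_on UNIV (\<lambda>y::config. y g)"
      by (rule continuous_on_product_coordinates)
    moreover have "open B" by (rule open_discrete)
    ultimately have "open ((\<lambda>y::config. y g) -` B)" by (rule open_vimage[rotated])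
    thus ?thesis by (simp add: vimage_def)
  qed
  hence "closed {y::config. y g \<in> A}" for g
    unfolding closed_def using \<open>\<And>g B. open {y::config. y g \<in> B}\<close>[of g "- A"]
    by (simp add: Compl_eq)
  hence "closed (\<Inter>g. {y::config. y g \<in> A})" by (intro closed_INT) auto
  moreover have "range (\<lambda>u. shift u \<eta>) \<subseteq> (\<Inter>g. {y::config. y g \<in> A})"
    using assms(1) by (auto simp: shift_def)
  ultimately have "orbit_closure \<eta> \<subseteq> (\<Inter>g. {y::config. y g \<in> A})"
    unfolding orbit_closure_def by (rule closure_minimal[rotated])
  thus ?thesis using assms(2) by auto
qed

definition line_through_origin :: "(real \<times> real) set \<Rightarrow> bool" where
  "line_through_origin l \<longleftrightarrow> subspace l \<and> dim l = 1"

text \<open>An oriented line through the origin is encoded by the open half-line consisting of all the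
  vectors that give its orientation; the underlying line is the span of this half-line, and the
  oppositely oriented line is \<open>uminus ` L\<close>.\<close>

type_synonym oriented_line = "(real \<times> real) set"

definition oriented :: "real \<times> real \<Rightarrow> oriented_line" where
  "oriented u = {c *\<^sub>R u | c. c > 0}"

definition orientations :: "(real \<times> real) set \<Rightarrow> oriented_line set" where
  "orientations l = {oriented u | u. u \<in> l \<and> u \<noteq> 0}"

definition oriented_lines :: "oriented_line set" where
  "oriented_lines = {oriented u | u. u \<noteq> 0}"

text \<open>The inequality does not depend on the orientation vector chosen (\<open>half_plane_oriented\<close>).\<close>

definition half_plane :: "oriented_line \<Rightarrow> (int \<times> int) set" where
  "half_plane L = {g. \<forall>u\<in>L. real_vec g \<bullet> (- snd u, fst u) \<ge> 0}"

lemma half_plane_oriented: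
  "half_plane (oriented u) = {g. real_vec g \<bullet> (- snd u, fst u) \<ge> 0}"
proof -
  have *: "real_vec g \<bullet> (- snd (c *\<^sub>R u), fst (c *\<^sub>R u)) = c * (real_vec g \<bullet> (- snd u, fst u))"
    for c g by (simp add: inner_prod_def algebra_simps)
  have "half_plane (oriented u) = {g. \<forall>c>0. 0 \<le> c * (real_vec g \<bullet> (- snd u, fst u))}"
    unfolding half_plane_def oriented_def *[symmetric] by blast
  also have "\<dots> = {g. 0 \<le> real_vec g \<bullet> (- snd u, fst u)}"
    by (auto simp: zero_le_mult_iff intro: gt_ex)
  finally show ?thesis by simp
qed

lemma orientations_span:
  assumes "u \<noteq> 0"
  shows "orientations (span {u}) = {oriented u, uminus ` oriented u}"
proof -
  have pos: "oriented (c *\<^sub>R u) = oriented u" if "c > 0" for c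
  proof (intro equalityI subsetI)
    fix x assume "x \<in> oriented (c *\<^sub>R u)"
    then obtain d where "d > 0" "x = d *\<^sub>R (c *\<^sub>R u)" unfolding oriented_def by blast
    hence "x = (d * c) *\<^sub>R u" "d * c > 0" using that by auto
    thus "x \<in> oriented u" unfolding oriented_def by blast
  next
    fix x assume "x \<in> oriented u"
    then obtain d where "d > 0" "x = d *\<^sub>R u" unfolding oriented_def by blast
    hence "x = (d / c) *\<^sub>R (c *\<^sub>R u)" "d / c > 0" using that by auto
    thus "x \<in> oriented (c *\<^sub>R u)" unfolding oriented_def by blast
  qed
  have neg: "oriented (- v) = uminus ` oriented v" for v
    unfolding oriented_def by (auto simp: image_iff)
  have cases: "oriented (c *\<^sub>R u) \<in> {oriented u, uminus ` oriented u}" if "c \<noteq> 0" for c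
  proof (cases "c > 0")
    case True thus ?thesis using pos by simp
  next
    case False
    with that have "oriented (- (c *\<^sub>R u)) = oriented u" using pos[of "- c"] by simp
    hence "oriented (c *\<^sub>R u) = uminus ` oriented u" using neg[of "- (c *\<^sub>R u)"] by simp
    thus ?thesis by simp
  qed
  have mem1: "oriented u \<in> orientations (span {u})"
    unfolding orientations_def using assms span_base[of u "{u}"] by blast
  have mem2: "uminus ` oriented u \<in> orientations (span {u})"
  proof -
    have "- u \<in> span {u}" "- u \<noteq> 0" using assms by (auto intro: span_neg span_base)
    thus ?thesis unfolding orientations_def neg[symmetric] by blast
  qed
  show ?thesis
  proof (intro equalityI subsetI)
    fix L assume "L \<in> orientations (span {u})"
    then obtain v where v: "L = oriented v" "v \<in> span {u}" "v \<noteq> 0"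
      unfolding orientations_def by blast
    from v(2) obtain c where c: "v = c *\<^sub>R u" unfolding span_singleton by blast
    with v(3) have "c \<noteq> 0" by auto
    thus "L \<in> {oriented u, uminus ` oriented u}" using cases[of c] v(1) c by simp
  next
    fix L assume "L \<in> {oriented u, uminus ` oriented u}"
    thus "L \<in> orientations (span {u})" using mem1 mem2 by (elim insertE) simp_all
  qed
qed

definition one_sided_expansive :: "config \<Rightarrow> oriented_line \<Rightarrow> bool" where
  "one_sided_expansive \<eta> L \<longleftrightarrow>
    (\<forall>x\<in>orbit_closure \<eta>. \<forall>y\<in>orbit_closure \<eta>. (\<forall>g\<in>half_plane L. x g = y g) \<longrightarrow> x = y)"

definition ONED :: "config \<Rightarrow> oriented_line set" where
  "ONED \<eta> = {L \<in> oriented_lines. \<not> one_sided_expansive \<eta> L}"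

end

theory Submission
  imports Defs
begin

text \<open>
  Let \<open>X\<close> be the orbit closure of \<open>\<eta>\<close> and \<open>M \<subseteq> X\<close> a minimal subshift. Everything rests on one claim: for some
  \<open>k\<close>, a point of \<open>X\<close> and a point of \<open>M\<close> that agree on the ball of radius \<open>k\<close> are equal
  (\<open>minimal_agreement_radius\<close>). Given this, points of \<open>M\<close> are determined by finitely many symbols, so \<open>M\<close> is
  finite; and a translate of \<open>\<eta>\<close> that agrees with a point of \<open>M\<close> on the ball is that point, so \<open>\<eta> \<in> M\<close>.
  A point with a finite orbit is fully periodic.

  Suppose the claim fails. Translating pairs that first differ at a far away point to that point and
  passing to a limit, as Boyle and Lind do, gives \<open>x \<in> X\<close> and \<open>y \<in> M\<close> that differ at the origin and agree on
  an open half-plane (\<open>limit_pair_agreeing_on_half_plane\<close>). The difference \<open>d = x - y\<close> is bounded and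
  annihilated by \<open>\<phi>\<close>. If a single exponent of \<open>\<phi>\<close> were extremal in the direction normal to the
  half-plane, the annihilation relation would give \<open>d 0 = 0\<close>. So an edge of the Newton polygon is parallel to the
  boundary, the boundary is a rational line, and along that line the first non-zero values of \<open>d\<close> satisfy a
  linear recurrence. A bounded integer solution of such a recurrence runs through finitely many states,
  so it is periodic, and this spreads to the whole plane: \<open>d\<close> has a period \<open>q\<close> along the boundary
  (\<open>real_half_plane_difference_periodic\<close>). Picture \<open>q\<close> as horizontal, with \<open>x\<close> and \<open>y\<close> agreeing above some
  level.

  The pair \<open>x\<close>, \<open>y\<close> shows that in \<open>X\<close> an upper half-plane does not determine the rest. The hypothesis on
  orientations therefore says that a lower half-plane does, and by compactness so does already a
  horizontal strip of some fixed width for everything above it. Consider all \<open>z \<in> X\<close> such that \<open>z - y\<close> is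
  \<open>q\<close>-periodic, and let \<open>N j\<close> be the number of different restrictions of these \<open>z\<close> to the strip at level \<open>j\<close>.
  This number is finite since \<open>z - y\<close> is periodic and bounded. As a strip determines all higher
  ones, \<open>N\<close> does not increase with \<open>j\<close>, and it drops strictly where \<open>x\<close> and \<open>y\<close> merge. On the other hand \<open>N\<close> is upper
  semicontinuous in \<open>y\<close>, and by minimality \<open>y\<close> is a limit of its own translates by vectors that go
  arbitrarily far down, where \<open>N\<close> is larger. This is a contradiction (\<open>recurrent_no_periodic_merging\<close>).
\<close>

(* Lattice points are treated as vectors; splitting quantified pairs into coordinates only obstructs. *)
declare split_paired_All [simp del] split_paired_Ex [simp del]

section \<open>Limits of configurations\<close>

text \<open>Configurations carry the product of discrete topologies, so convergence means that every single
  symbol is eventually constant.\<close>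

lemma tendsto_config_iff:
  fixes f :: "'k \<Rightarrow> config"
  shows "(f \<longlongrightarrow> x) F \<longleftrightarrow> (\<forall>g. \<forall>\<^sub>F k in F. f k g = x g)"
proof -
  have "(f \<longlongrightarrow> x) F \<longleftrightarrow> limitin (product_topology (\<lambda>_. euclidean) UNIV) f x F"
    by (simp add: euclidean_product_topology)
  also have "\<dots> \<longleftrightarrow> (\<forall>g. \<forall>\<^sub>F k in F. f k g = x g)"
    by (simp add: limitin_componentwise tendsto_discrete)
  finally show ?thesis .
qed

lemma compact_alphabet:
  fixes A :: "int set"
  assumes "finite A"
  shows "compact {x :: config. range x \<subseteq> A}"
proof -
  have "{x :: config. range x \<subseteq> A} = PiE UNIV (\<lambda>_. A)"
    by (auto simp: PiE_UNIV_domain Pi_def)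
  moreover have "compactin (product_topology (\<lambda>_. euclidean) UNIV) (PiE UNIV (\<lambda>_ :: int \<times> int. A))"
    unfolding compactin_PiE using assms by (simp add: finite_imp_compact)
  ultimately show ?thesis
    by (simp add: euclidean_product_topology)
qed

text \<open>With this instance the space of configurations is first countable as well, because the lattice is
  countable. Hence compactness yields convergent subsequences, and closures are sets of limits of
  sequences.\<close>

instance int :: first_countable_topology
proof
  fix x :: int
  show "\<exists>\<U> :: nat \<Rightarrow> int set. (\<forall>i. x \<in> \<U> i \<and> open (\<U> i)) \<and>
          (\<forall>S. open S \<and> x \<in> S \<longrightarrow> (\<exists>i. \<U> i \<subseteq> S))"
    by (rule exI[of _ "\<lambda>_. {x}"]) (auto intro: open_discrete)
qed

lemma config_subsequence:
  fixes f :: "nat \<Rightarrow> config"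
  assumes "finite A" and "\<And>k. range (f k) \<subseteq> A"
  obtains r x where "strict_mono r" and "(\<lambda>k. f (r k)) \<longlonglongrightarrow> x"
proof -
  have "seq_compact {x :: config. range x \<subseteq> A}"
    using compact_alphabet[OF assms(1)] by (rule compact_imp_seq_compact)
  thus thesis
    using assms(2) that by (elim seq_compactE[of _ f]) (auto simp: comp_def)
qed

lemma config_pair_subsequence:
  fixes f f' :: "nat \<Rightarrow> config"
  assumes "finite A" and "\<And>k. range (f k) \<subseteq> A" and "\<And>k. range (f' k) \<subseteq> A"
  obtains r x x' where "strict_mono r" and "(\<lambda>k. f (r k)) \<longlonglongrightarrow> x" and "(\<lambda>k. f' (r k)) \<longlonglongrightarrow> x'"
proof -
  obtain r x where r: "strict_mono r" "(\<lambda>k. f (r k)) \<longlonglongrightarrow> x"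
    using config_subsequence[OF assms(1,2)] .
  obtain r' x' where r': "strict_mono r'" "(\<lambda>k. f' (r (r' k))) \<longlonglongrightarrow> x'"
    using config_subsequence[of A "\<lambda>k. f' (r k)"] assms(1,3) .
  show thesis
  proof (rule that)
    show "strict_mono (r \<circ> r')" by (rule strict_mono_o[OF r(1) r'(1)])
    show "(\<lambda>k. f ((r \<circ> r') k)) \<longlonglongrightarrow> x"
      using LIMSEQ_subseq_LIMSEQ[OF r(2) r'(1)] by (simp add: comp_def)
    show "(\<lambda>k. f' ((r \<circ> r') k)) \<longlonglongrightarrow> x'" using r'(2) by simp
  qed
qed

definition shift_invariant :: "config set \<Rightarrow> bool" where
  "shift_invariant X \<longleftrightarrow> (\<forall>u. \<forall>x\<in>X. shift u x \<in> X)"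

lemma shift_apply [simp]: "shift u x g = x (g + u)"
  by (simp add: shift_def)

lemma shift_shift [simp]: "shift u (shift v x) = shift (u + v) x"
  by (rule ext) (simp add: ac_simps)

lemma shift_zero [simp]: "shift 0 x = x"
  by (rule ext) simp

lemma tendsto_shift:
  assumes "(f \<longlongrightarrow> x) F"
  shows "((\<lambda>k. shift u (f k)) \<longlongrightarrow> shift u x) F"
  using assms by (simp add: tendsto_config_iff)

lemma shift_invariant_closure:
  assumes "shift_invariant S"
  shows "shift_invariant (closure S)"
  unfolding shift_invariant_def
proof (intro allI ballI)
  fix u x assume "x \<in> closure S"
  then obtain f where f: "\<And>k. f k \<in> S" "f \<longlonglongrightarrow> x"
    unfolding closure_sequential by blast
  have "\<forall>k. shift u (f k) \<in> S" using assms f(1) by (simp add: shift_invariant_def)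
  thus "shift u x \<in> closure S"
    unfolding closure_sequential using tendsto_shift[OF f(2), of u]
    by (intro exI[of _ "\<lambda>k. shift u (f k)"] conjI)
qed

lemma orbit_closure_closed: "closed (orbit_closure \<eta>)"
  by (simp add: orbit_closure_def)

lemma orbit_closure_shift_invariant: "shift_invariant (orbit_closure \<eta>)"
  unfolding orbit_closure_def
  by (rule shift_invariant_closure) (auto simp: shift_invariant_def)

lemma orbit_closure_self: "\<eta> \<in> orbit_closure \<eta>"
  unfolding orbit_closure_def
  by (rule subsetD[OF closure_subset]) (metis rangeI shift_zero)

text \<open>The relation at a given point involves finitely many symbols, so it passes to limits.\<close>

lemma orbit_closure_annihilates:
  assumes "annihilates \<phi> \<eta>" and "x \<in> orbit_closure \<eta>"
  shows "annihilates \<phi> x"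
  unfolding annihilates_def
proof
  fix g
  obtain f where f: "\<And>k. f k \<in> range (\<lambda>u. shift u \<eta>)" "f \<longlonglongrightarrow> x"
    using assms(2) unfolding orbit_closure_def closure_sequential by blast
  have "\<forall>\<^sub>F k in sequentially. \<forall>v\<in>Poly_Mapping.keys \<phi>. f k (g - v) = x (g - v)"
    using f(2) by (intro eventually_ball_finite) (auto simp: tendsto_config_iff)
  then obtain k where "\<forall>v\<in>Poly_Mapping.keys \<phi>. f k (g - v) = x (g - v)"
    by (auto dest: eventually_happens)
  moreover obtain u where "f k = shift u \<eta>" using f(1)[of k] by blast
  ultimately have u: "\<And>v. v \<in> Poly_Mapping.keys \<phi> \<Longrightarrow> shift u \<eta> (g - v) = x (g - v)" by simp
  have "(\<Sum>v\<in>Poly_Mapping.keys \<phi>. Poly_Mapping.lookup \<phi> v * x (g - v)) =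
        (\<Sum>v\<in>Poly_Mapping.keys \<phi>. Poly_Mapping.lookup \<phi> v * \<eta> ((g + u) - v))"
  proof (rule sum.cong[OF refl])
    fix v assume "v \<in> Poly_Mapping.keys \<phi>"
    hence "shift u \<eta> (g - v) = x (g - v)" using u by blast
    thus "Poly_Mapping.lookup \<phi> v * x (g - v) = Poly_Mapping.lookup \<phi> v * \<eta> (g + u - v)"
      by (simp add: algebra_simps)
  qed
  thus "(\<Sum>v\<in>Poly_Mapping.keys \<phi>. Poly_Mapping.lookup \<phi> v * x (g - v)) = 0"
    using assms(1) by (simp add: annihilates_def)
qed

section \<open>Lattice geometry relative to an integer vector\<close>

text \<open>The determinant of \<open>q\<close> and \<open>g\<close>. Its level sets are the lattice lines parallel to \<open>q\<close>, and it is
  positive to the left of \<open>q\<close>: if \<open>q\<close> is pictured as pointing to the right, it measures how high \<open>g\<close> lies.\<close>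

definition height :: "int \<times> int \<Rightarrow> int \<times> int \<Rightarrow> int" where
  "height q g = fst q * snd g - snd q * fst g"

lemma height_add [simp]: "height q (g + h) = height q g + height q h"
  by (simp add: height_def algebra_simps)
lemma height_diff [simp]: "height q (g - h) = height q g - height q h"
  by (simp add: height_def algebra_simps)
lemma height_minus [simp]: "height q (- g) = - height q g"
  by (simp add: height_def algebra_simps)
lemma height_self [simp]: "height q q = 0"
  by (simp add: height_def)
lemma height_zero [simp]: "height q 0 = 0"
  by (simp add: height_def)

lemma exists_height_ge:
  assumes "q \<noteq> 0"
  obtains v where "height q v \<ge> c"
proof -
  define s where "s = fst q * fst q + snd q * snd q"
  have "s > 0" using assms unfolding s_def by (simp add: sum_squares_gt_zero_iff prod_eq_iff)
  hence "\<bar>c\<bar> * s \<ge> \<bar>c\<bar>" by (simp add: mult_le_cancel_left1)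
  moreover have "height q (\<bar>c\<bar> * - snd q, \<bar>c\<bar> * fst q) = \<bar>c\<bar> * s"
    by (simp add: height_def s_def algebra_simps)
  ultimately show thesis
    using that[of "(\<bar>c\<bar> * - snd q, \<bar>c\<bar> * fst q)"] by linarith
qed

text \<open>Multiplication by integers, which has no notation on pairs.\<close>

definition scale :: "int \<Rightarrow> int \<times> int \<Rightarrow> int \<times> int" where
  "scale k h = (k * fst h, k * snd h)"

lemma scale_add: "scale (k + l) h = scale k h + scale l h"
  by (simp add: scale_def prod_eq_iff algebra_simps)
lemma scale_diff: "scale (k - l) h = scale k h - scale l h"
  by (simp add: scale_def prod_eq_iff algebra_simps)
lemma scale_0 [simp]: "scale 0 h = 0"
  by (simp add: scale_def prod_eq_iff)
lemma height_scale_right [simp]: "height q (scale k h) = k * height q h"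
  by (simp add: height_def scale_def algebra_simps)
lemma height_scale_left [simp]: "height (scale k q) h = k * height q h"
  by (simp add: height_def scale_def algebra_simps)
lemma scale_eq_0_iff [simp]: "scale k h = 0 \<longleftrightarrow> k = 0 \<or> h = 0"
  by (auto simp: scale_def prod_eq_iff)

text \<open>Dividing \<open>h\<close> by the greatest common divisor of its coordinates gives a generator of the lattice points
  on its line; the multiplier of such a point is read off from a Bezout identity.\<close>

lemma primitive_vector:
  assumes "h \<noteq> 0"
  obtains h0 k where "h0 \<noteq> 0" "h = scale k h0" "\<And>g. height h0 g = 0 \<Longrightarrow> \<exists>l. g = scale l h0"
proof -
  define k where "k = gcd (fst h) (snd h)"
  have "k \<noteq> 0" using assms by (simp add: k_def prod_eq_iff)
  define h0 where "h0 = (fst h div k, snd h div k)"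
  have h: "h = scale k h0" by (simp add: h0_def scale_def k_def)
  hence "h0 \<noteq> 0" using assms by auto
  obtain r s where "r * fst h + s * snd h = k"
    unfolding k_def using bezout_int by blast
  hence "k * (r * fst h0 + s * snd h0) = k * 1"
    by (subst (asm) (1 2) h) (simp add: scale_def algebra_simps)
  hence rs: "r * fst h0 + s * snd h0 = 1" using \<open>k \<noteq> 0\<close> by (simp only: mult_cancel_left) simp
  have "g = scale (r * fst g + s * snd g) h0" if "height h0 g = 0" for g
  proof -
    have eq: "fst h0 * snd g = snd h0 * fst g" using that by (simp add: height_def)
    have "(r * fst g + s * snd g) * fst h0 = r * fst h0 * fst g + s * (fst h0 * snd g)"
      by (simp add: algebra_simps)
    also have "\<dots> = (r * fst h0 + s * snd h0) * fst g" by (simp add: eq algebra_simps)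
    finally have 1: "(r * fst g + s * snd g) * fst h0 = fst g" by (simp add: rs)
    have "(r * fst g + s * snd g) * snd h0 = r * (snd h0 * fst g) + s * snd h0 * snd g"
      by (simp add: algebra_simps)
    also have "\<dots> = (r * fst h0 + s * snd h0) * snd g"
      unfolding eq[symmetric] by (simp add: algebra_simps)
    finally show ?thesis using 1 by (simp add: rs scale_def)
  qed
  thus thesis using that \<open>h0 \<noteq> 0\<close> h by blast
qed

lemma periodic_scale:
  assumes "\<And>g. d (g + q) = d g"
  shows "d (g + scale k q) = d g"
proof -
  have nat: "d (g + scale (int k) q) = d g" for g k
  proof (induction k)
    case (Suc k)
    have "scale (int (Suc k)) q = scale (int k) q + q"
      by (simp add: scale_def prod_eq_iff algebra_simps)
    thus ?case using Suc assms[of "g + scale (int k) q"] by (simp add: add.assoc)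
  qed simp
  show ?thesis
  proof (cases "k \<ge> 0")
    case True
    thus ?thesis using nat[of g "nat k"] by simp
  next
    case False
    have "g + scale k q + scale (int (nat (- k))) q = g"
      using False by (simp add: scale_def prod_eq_iff)
    thus ?thesis using nat[of "g + scale k q" "nat (- k)"] by metis
  qed
qed

text \<open>A strip of finite width parallel to \<open>q\<close> is finite modulo \<open>q\<close>, so a \<open>q\<close>-periodic function on it is given by
  its values on a finite set. The representatives are the points of the strip whose inner product with
  \<open>q\<close> is reduced modulo the squared length of \<open>q\<close>.\<close>

lemma strip_fundamental_domain:
  assumes "q \<noteq> 0"
  obtains F where "finite F" and "\<And>g. g \<in> F \<Longrightarrow> 0 \<le> height q g"
    and "\<And>g. 0 \<le> height q g \<Longrightarrow> height q g < w \<Longrightarrow> \<exists>k. g + scale k q \<in> F"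
proof -
  define dot where "dot g = fst g * fst q + snd g * snd q" for g :: "int \<times> int"
  define N where "N = fst q * fst q + snd q * snd q"
  have "N > 0" unfolding N_def using assms by (simp add: sum_squares_gt_zero_iff prod_eq_iff)
  define F where "F = {g. 0 \<le> height q g \<and> height q g < w \<and> 0 \<le> dot g \<and> dot g < N}"
  have coord: "N * fst g = fst q * dot g - snd q * height q g" "N * snd g = snd q * dot g + fst q * height q g" for g
    by (simp_all add: N_def dot_def height_def algebra_simps)
  have "inj_on (\<lambda>g. (height q g, dot g)) F"
  proof (rule inj_onI)
    fix g h assume "(height q g, dot g) = (height q h, dot h)"
    hence "N * fst g = N * fst h" "N * snd g = N * snd h" by (simp_all add: coord)
    thus "g = h" using \<open>N > 0\<close> by (simp add: prod_eq_iff)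
  qed
  moreover have "finite ((\<lambda>g. (height q g, dot g)) ` F)"
    by (rule finite_subset[of _ "{0..<w} \<times> {0..<N}"]) (auto simp: F_def)
  ultimately have "finite F" by (rule finite_imageD[rotated])
  moreover have "\<exists>k. g + scale k q \<in> F" if "0 \<le> height q g" "height q g < w" for g
  proof -
    have "dot (g + scale k q) = dot g + k * N" for k
      by (simp add: dot_def scale_def N_def algebra_simps)
    from this[of "- (dot g div N)"] have "dot (g + scale (- (dot g div N)) q) = dot g mod N"
      by (simp add: minus_div_mult_eq_mod)
    thus ?thesis using that \<open>N > 0\<close> by (intro exI[of _ "- (dot g div N)"]) (simp add: F_def)
  qed
  moreover have "0 \<le> height q g" if "g \<in> F" for g using that by (simp add: F_def)
  ultimately show thesis by (intro that)
qed

section \<open>Minimal subshifts\<close>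

definition minimal_subshift :: "config set \<Rightarrow> bool" where
  "minimal_subshift M \<longleftrightarrow> closed M \<and> M \<noteq> {} \<and> shift_invariant M \<and>
     (\<forall>N\<subseteq>M. closed N \<and> N \<noteq> {} \<and> shift_invariant N \<longrightarrow> N = M)"

lemma nested_closed_Inter_nonempty:
  assumes "compact X" and "\<And>S. S \<in> \<C> \<Longrightarrow> closed S \<and> S \<noteq> {} \<and> S \<subseteq> X"
    and "\<And>S T. S \<in> \<C> \<Longrightarrow> T \<in> \<C> \<Longrightarrow> S \<subseteq> T \<or> T \<subseteq> S" and "\<C> \<noteq> {}"
  shows "\<Inter>\<C> \<noteq> {}"
proof -
  have fip: "X \<inter> \<Inter>\<F> \<noteq> {}" if "finite \<F>" "\<F> \<subseteq> \<C>" for \<F>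
  proof -
    have "\<exists>S\<in>\<C>. S \<subseteq> \<Inter>\<F>"
      using that
    proof (induction \<F> rule: finite_induct)
      case empty
      thus ?case using assms(4) by blast
    next
      case (insert T \<F>)
      then obtain S where "S \<in> \<C>" "S \<subseteq> \<Inter>\<F>" by auto
      moreover have "T \<in> \<C>" using insert by simp
      ultimately show ?case using assms(3)[of S T] by auto
    qed
    thus ?thesis using assms(2) by blast
  qed
  have closed: "closed S" if "S \<in> \<C>" for S using assms(2)[OF that] by blast
  have "X \<inter> \<Inter>\<C> \<noteq> {}"
    by (rule compact_imp_fip[OF assms(1) closed fip])
  thus ?thesis by blast
qed

text \<open>Zorn's lemma for the relative complements of subshifts: by compactness, the intersection of a
  chain of nonempty closed sets is nonempty.\<close>

lemma minimal_subshift_exists: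
  assumes "compact X" and "closed X" and "X \<noteq> {}" and "shift_invariant X"
  obtains M where "minimal_subshift M" and "M \<subseteq> X"
proof -
  define \<A> where "\<A> = {U. closed (X - U) \<and> X - U \<noteq> {} \<and> shift_invariant (X - U) \<and> U \<subseteq> X}"
  have "\<exists>U\<in>\<A>. \<forall>V\<in>\<A>. U \<subseteq> V \<longrightarrow> V = U"
  proof (rule subset_Zorn_nonempty)
    show "\<A> \<noteq> {}" using assms by (auto simp: \<A>_def intro!: exI[of _ "{}"])
  next
    fix \<C> assume \<C>: "\<C> \<noteq> {}" "subset.chain \<A> \<C>"
    have eq: "X - \<Union>\<C> = \<Inter>((\<lambda>U. X - U) ` \<C>)" using \<C>(1) by auto
    have mem: "\<And>U. U \<in> \<C> \<Longrightarrow> U \<in> \<A>" using \<C>(2) by (auto simp: subset_chain_def)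
    have "X - \<Union>\<C> \<noteq> {}"
      unfolding eq
    proof (rule nested_closed_Inter_nonempty[OF assms(1)])
      show "S \<subseteq> T \<or> T \<subseteq> S" if ST: "S \<in> (-) X ` \<C>" "T \<in> (-) X ` \<C>" for S T
      proof -
        obtain U V where UV: "U \<in> \<C>" "V \<in> \<C>" "S = X - U" "T = X - V" using ST by blast
        hence "U \<subseteq> V \<or> V \<subseteq> U" using \<C>(2) by (simp add: subset_chain_def)
        thus ?thesis unfolding UV(3,4) by blast
      qed
    qed (use mem \<C>(1) in \<open>auto simp: \<A>_def\<close>)
    moreover have "closed (X - \<Union>\<C>)" unfolding eq using mem by (intro closed_Inter) (auto simp: \<A>_def)
    moreover have "shift_invariant (X - \<Union>\<C>)"
      using mem \<C>(1) unfolding eq by (auto simp: \<A>_def shift_invariant_def)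
    ultimately show "\<Union>\<C> \<in> \<A>" using mem by (auto simp: \<A>_def)
  qed
  then obtain U where U: "U \<in> \<A>" "\<And>V. V \<in> \<A> \<Longrightarrow> U \<subseteq> V \<Longrightarrow> V = U" by blast
  have "N = X - U" if "N \<subseteq> X - U" "closed N" "N \<noteq> {}" "shift_invariant N" for N
  proof -
    have N: "X - (X - N) = N" using that by auto
    have "X - N \<in> \<A>" unfolding \<A>_def mem_Collect_eq N using that by auto
    moreover have "U \<subseteq> X - N" using U(1) that by (auto simp: \<A>_def)
    ultimately have "X - N = U" by (rule U(2))
    thus ?thesis using N by simp
  qed
  hence "minimal_subshift (X - U)"
    using U(1) by (auto simp: minimal_subshift_def \<A>_def)
  thus thesis using that by blast
qed

text \<open>The limit points of translates of \<open>y\<close> by vectors that go down without bound form a closed set which is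
  invariant under all shifts, since a fixed shift changes heights by a bounded amount. By
  minimality this set is all of \<open>M\<close>, so it contains \<open>y\<close>.\<close>

lemma minimal_recurrent_downward:
  assumes min: "minimal_subshift M" and "compact M" and "q \<noteq> 0" and "y \<in> M"
  obtains v where "\<And>k. height q (v k) \<le> c" and "(\<lambda>k. shift (v k) y) \<longlonglongrightarrow> y"
proof -
  define K where "K c = closure ((\<lambda>v. shift v y) ` {v. height q v \<le> c})" for c
  have inv: "shift_invariant M" and "closed M" using min by (auto simp: minimal_subshift_def)
  have anti: "K c \<subseteq> K c'" if "c \<le> c'" for c c'
    unfolding K_def using that by (intro closure_mono image_mono) auto
  have sub: "K c \<subseteq> M" for c
    unfolding K_def using inv \<open>closed M\<close> \<open>y \<in> M\<close>
    by (intro closure_minimal) (auto simp: shift_invariant_def)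
  have ne: "K c \<noteq> {}" for c
  proof -
    obtain v where "height q v \<ge> - c" using exists_height_ge[OF \<open>q \<noteq> 0\<close>] .
    hence "height q (- v) \<le> c" by simp
    thus ?thesis unfolding K_def closure_eq_empty by blast
  qed
  have "\<Inter>(range K) \<noteq> {}"
  proof (rule nested_closed_Inter_nonempty[OF \<open>compact M\<close>])
    show "S \<subseteq> T \<or> T \<subseteq> S" if "S \<in> range K" "T \<in> range K" for S T
      using that anti by (metis linear rangeE)
  qed (use ne sub in \<open>auto simp: K_def\<close>)
  moreover have "shift u z \<in> K c" if "z \<in> \<Inter>(range K)" for u z c
  proof -
    have "z \<in> K (c - height q u)" using that by blast
    then obtain f where f: "\<And>k. f k \<in> (\<lambda>v. shift v y) ` {v. height q v \<le> c - height q u}" "f \<longlonglongrightarrow> z"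
      unfolding K_def closure_sequential by blast
    have "shift u (f k) \<in> (\<lambda>v. shift v y) ` {v. height q v \<le> c}" for k
      using f(1)[of k] by (auto intro!: image_eqI[of _ _ "u + _"])
    thus ?thesis
      unfolding K_def closure_sequential using tendsto_shift[OF f(2), of u]
      by (intro exI[of _ "\<lambda>k. shift u (f k)"] conjI allI)
  qed
  hence "shift_invariant (\<Inter>(range K))" by (simp add: shift_invariant_def)
  moreover have "closed (\<Inter>(range K))" by (intro closed_INT) (simp add: K_def)
  moreover have "\<Inter>(range K) \<subseteq> M" using sub by blast
  ultimately have "\<Inter>(range K) = M"
    using min unfolding minimal_subshift_def by simp
  hence "y \<in> K c" using \<open>y \<in> M\<close> by blast
  then obtain f where f: "\<And>k. f k \<in> (\<lambda>v. shift v y) ` {v. height q v \<le> c}" "f \<longlonglongrightarrow> y"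
    unfolding K_def closure_sequential by blast
  have "\<exists>v. height q v \<le> c \<and> f k = shift v y" for k using f(1)[of k] by blast
  then obtain v where v: "\<And>k. height q (v k) \<le> c" "\<And>k. f k = shift (v k) y" by metis
  have "f = (\<lambda>k. shift (v k) y)" by (rule ext) (rule v(2))
  thus thesis using that[of v] v(1) f(2) by simp
qed

section \<open>Bounded differences that vanish on a half-plane\<close>

text \<open>Among \<open>card S + 1\<close> consecutive states two coincide, at a distance that divides the factorial. The
  starting point is chosen far enough to the left for the repetition to have set in at \<open>t\<close>. The
  factorial makes the period depend on the number of states only, not on the sequence.\<close>

lemma deterministic_finite_periodic:
  fixes f :: "int \<Rightarrow> 's"
  assumes "finite S" and "range f \<subseteq> S" and det: "\<And>s t. f s = f t \<Longrightarrow> f (s + 1) = f (t + 1)"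
  shows "f (t + fact (card S)) = f t"
proof -
  define Q where "Q = card S"
  have "card ((\<lambda>i. f (t - int Q + int i)) ` {..Q}) \<le> Q"
    unfolding Q_def using assms by (intro card_mono) auto
  hence "\<not> inj_on (\<lambda>i. f (t - int Q + int i)) {..Q}"
    by (intro pigeonhole) simp
  then obtain i j where ij: "i \<le> Q" "j \<le> Q" "f (t - int Q + int i) = f (t - int Q + int j)" "i < j"
    unfolding inj_on_def by (metis atMost_iff linorder_neqE_nat)
  have step: "f (t - int Q + int i + int k) = f (t - int Q + int j + int k)" for k
  proof (induction k)
    case (Suc k)
    show ?case using det[OF Suc] by (simp add: ac_simps)
  qed (use ij in simp)
  have per: "f (s + int (j - i)) = f s" if "s \<ge> t" for s
    using step[of "nat (s - (t - int Q + int i))"] that ij by (simp add: algebra_simps of_nat_diff)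
  have "(j - i) dvd fact Q" using ij by (intro dvd_fact) auto
  then obtain m where m: "fact Q = (j - i) * m" by blast
  have "f (t + int ((j - i) * m)) = f t" for m
  proof (induction m)
    case (Suc m)
    have "f (t + int ((j - i) * m) + int (j - i)) = f (t + int ((j - i) * m))"
      by (rule per) simp
    moreover have "t + int ((j - i) * Suc m) = t + int ((j - i) * m) + int (j - i)"
      by (simp only: mult_Suc_right of_nat_add add.assoc add.commute[of "int (j - i)"])
    ultimately show ?case using Suc by metis
  qed simp
  hence "f (t + int (fact Q)) = f t" by (simp only: m)
  thus ?thesis by (simp add: Q_def)
qed

text \<open>A common period of all recurrent sequences with memory \<open>K\<close> and values in \<open>{-C..C}\<close>; the states are the
  windows of \<open>K + 1\<close> consecutive values.\<close>

definition window_period :: "nat \<Rightarrow> int \<Rightarrow> int" where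
  "window_period K C = fact (card ({..K} \<rightarrow>\<^sub>E {-C..C}))"

lemma bounded_recurrence_periodic:
  fixes s :: "int \<Rightarrow> int"
  assumes bound: "\<And>t. \<bar>s t\<bar> \<le> C"
    and det: "\<And>t t'. (\<And>k. 1 \<le> k \<Longrightarrow> k \<le> K \<Longrightarrow> s (t - int k) = s (t' - int k)) \<Longrightarrow> s t = s t'"
  shows "s (t + window_period K C) = s t"
proof -
  define f where "f t = restrict (\<lambda>i. s (t - int i)) {..K}" for t
  have f: "f t i = s (t - int i)" if "i \<le> K" for t i using that by (simp add: f_def)
  have "f (t + window_period K C) = f t"
    unfolding window_period_def
  proof (rule deterministic_finite_periodic)
    show "finite ({..K} \<rightarrow>\<^sub>E {-C..C})" by (intro finite_PiE) auto
    have "s t \<in> {-C..C}" for t using bound[of t] by auto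
    hence "f t \<in> {..K} \<rightarrow>\<^sub>E {-C..C}" for t
      unfolding f_def restrict_PiE_iff by blast
    thus "range f \<subseteq> {..K} \<rightarrow>\<^sub>E {-C..C}" by blast
  next
    fix a b assume ab: "f a = f b"
    have eq: "s (a - int i) = s (b - int i)" if "i \<le> K" for i
      using f[OF that] ab by metis
    have "s (a + 1 - int i) = s (b + 1 - int i)" if "i \<le> K" for i
    proof (cases i)
      case 0
      have "s (a + 1) = s (b + 1)"
      proof (rule det)
        fix k :: nat assume "1 \<le> k" "k \<le> K"
        thus "s (a + 1 - int k) = s (b + 1 - int k)"
          using eq[of "k - 1"] by (simp add: of_nat_diff algebra_simps)
      qed
      thus ?thesis using 0 by simp
    next
      case (Suc k)
      thus ?thesis using eq[of k] that by simp
    qed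
    thus "f (a + 1) = f (b + 1)" by (auto simp: f_def restrict_def)
  qed
  thus ?thesis using f[of 0] by (metis bot_nat_0.extremum diff_zero of_nat_0)
qed

lemma annihilates_shift_diff:
  assumes "annihilates \<phi> x" and "annihilates \<phi> y"
  shows "annihilates \<phi> (\<lambda>g. x (g + u) - y g)"
  unfolding annihilates_def
proof
  fix g
  have "x (g - v + u) = x (g + u - v)" for v by (simp add: algebra_simps)
  thus "(\<Sum>v\<in>Poly_Mapping.keys \<phi>. Poly_Mapping.lookup \<phi> v * (x (g - v + u) - y (g - v))) = 0"
    using assms by (simp add: annihilates_def algebra_simps sum_subtractf)
qed

text \<open>The relation at a point expresses one value of \<open>d\<close> by others. It is used so that only exponents of
  maximal height contribute on the topmost line where \<open>d\<close> may be non-zero; these exponents lie on one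
  line, and they give a recurrence along that line. The period is obtained for all lines at once, by
  descending induction on the height, applied to the increment \<open>e\<close> of \<open>d\<close> under a candidate period. If
  \<open>e\<close> vanishes above a line, then on that line \<open>e\<close> satisfies the recurrence and is periodic; so \<open>d\<close> grows
  linearly there along the period, and being bounded it has \<open>e = 0\<close>.\<close>

lemma vanishing_half_plane_periodic:
  assumes "\<phi> \<noteq> 0" and ann: "annihilates \<phi> d" and bound: "\<And>g. \<bar>d g\<bar> \<le> C"
    and h: "h \<noteq> 0" and prim: "\<And>g. height h g = 0 \<Longrightarrow> \<exists>l. g = scale l h"
    and van: "\<And>g. height h g > 0 \<Longrightarrow> d g = 0"
  obtains R where "R > 0" and "\<And>g. d (g + scale R h) = d g"
proof -
  define U where "U = Poly_Mapping.keys \<phi>"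
  have U: "finite U" "U \<noteq> {}" using assms(1) by (auto simp: U_def)
  define m where "m = Max (height h ` U)"
  define E where "E = {u \<in> U. height h u = m}"
  have "m \<in> height h ` U" unfolding m_def using U by (intro Max_in) auto
  hence E: "finite E" "E \<noteq> {}" using U by (auto simp: E_def)
  have le_m: "height h u \<le> m" if "u \<in> U" for u unfolding m_def using U that by (intro Max_ge) auto
  define dot where "dot u = fst u * fst h + snd u * snd h" for u :: "int \<times> int"
  \<comment> \<open>The leftmost exponent of maximal height: the others of that height refer to values further left.\<close>
  obtain u0 where u0: "u0 \<in> E" "\<And>u. u \<in> E \<Longrightarrow> dot u0 \<le> dot u"
    using ex_min_if_finite[of "dot ` E"] E by (fastforce simp: not_less)
  have hpos: "fst h * fst h + snd h * snd h > 0"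
    using h by (simp add: sum_squares_gt_zero_iff prod_eq_iff)
  have "\<exists>k::nat. u = u0 + scale (int k) h" if "u \<in> E" for u
  proof -
    have "height h (u - u0) = 0" using that u0(1) by (simp add: E_def)
    then obtain l where l: "u - u0 = scale l h" using prim by blast
    hence u: "u = u0 + scale l h" by (simp add: algebra_simps)
    have "dot u = dot u0 + l * (fst h * fst h + snd h * snd h)"
      unfolding u by (simp add: dot_def scale_def algebra_simps)
    hence "l * (fst h * fst h + snd h * snd h) \<ge> 0" using u0(2)[OF that] by simp
    hence "l \<ge> 0" using hpos by (simp add: zero_le_mult_iff)
    thus ?thesis using u by (intro exI[of _ "nat l"]) simp
  qed
  then obtain \<kappa> :: "int \<times> int \<Rightarrow> nat" where \<kappa>: "\<And>u. u \<in> E \<Longrightarrow> u = u0 + scale (int (\<kappa> u)) h"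
    by metis
  define K where "K = Max (\<kappa> ` E)"
  have K: "\<kappa> u \<le> K" if "u \<in> E" for u unfolding K_def using E that by (intro Max_ge) auto
  \<comment> \<open>The bound is doubled since the recurrence is applied to differences of two values of \<open>d\<close>.\<close>
  define R where "R = window_period K (2 * C)"
  have "R > 0" by (simp add: R_def window_period_def)
  define q where "q = scale R h"
  define e where "e g = d (g + q) - d g" for g
  have ann_e: "annihilates \<phi> e"
    unfolding e_def by (rule annihilates_shift_diff[OF ann ann])
  have bound_e: "\<bar>e g\<bar> \<le> 2 * C" for g
    using bound[of g] bound[of "g + q"] by (simp add: e_def)
  have top: "e g = 0" if "height h g > 0" for g
    using van[of g] van[of "g + q"] that by (simp add: e_def q_def)
  have "e g = 0" if "height h g = - int j" for j g
    using that
  proof (induction j arbitrary: g rule: less_induct)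
    case (less j)
    have above: "e g' = 0" if "height h g' > - int j" for g'
    proof (cases "height h g' > 0")
      case False
      thus ?thesis using less.IH[of "nat (- height h g')" g'] that by simp
    qed (rule top)
    define s where "s t = e (g + scale t h)" for t
    have per: "s (t + R) = s t" for t
      unfolding R_def
    proof (rule bounded_recurrence_periodic)
      show "\<bar>s t\<bar> \<le> 2 * C" for t unfolding s_def by (rule bound_e)
    next
      fix t t' assume agree: "\<And>k. 1 \<le> k \<Longrightarrow> k \<le> K \<Longrightarrow> s (t - int k) = s (t' - int k)"
      define w where "w t u = e (g + scale t h + u0 - u)" for t u
      have sum0: "(\<Sum>u\<in>U. Poly_Mapping.lookup \<phi> u * w t u) = 0" for t
        using ann_e unfolding annihilates_def U_def w_def by blast
      have eq: "w t u = w t' u" if "u \<in> U - {u0}" for u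
      proof (cases "u \<in> E")
        case True
        have "1 \<le> \<kappa> u" using \<kappa>[OF True] that by (cases "\<kappa> u") auto
        moreover have "w t u = s (t - int (\<kappa> u))" for t
          unfolding w_def s_def by (subst \<kappa>[OF True]) (simp add: scale_diff algebra_simps)
        ultimately show ?thesis using agree[of "\<kappa> u"] K[OF True] by simp
      next
        case False
        hence "height h u < m" using le_m[of u] that by (auto simp: E_def less_le)
        hence "height h (g + scale t h + u0 - u) > - int j" for t
          using u0(1) less.prems by (simp add: E_def)
        thus ?thesis using above by (simp add: w_def)
      qed
      have split: "(\<Sum>u\<in>U. Poly_Mapping.lookup \<phi> u * w t u) =
          Poly_Mapping.lookup \<phi> u0 * s t + (\<Sum>u\<in>U - {u0}. Poly_Mapping.lookup \<phi> u * w t u)" for t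
        using U u0(1) by (subst sum.remove[of U u0]) (auto simp: E_def w_def s_def)
      have "Poly_Mapping.lookup \<phi> u0 * s t = Poly_Mapping.lookup \<phi> u0 * s t'"
        using sum0[of t] sum0[of t'] eq unfolding split by (simp add: add_eq_0_iff2)
      moreover have "Poly_Mapping.lookup \<phi> u0 \<noteq> 0"
        using u0(1) by (simp add: E_def U_def in_keys_iff)
      ultimately show "s t = s t'" by simp
    qed
    have s0: "s (int k * R) = s 0" for k
    proof (induction k)
      case (Suc k)
      thus ?case using per[of "int k * R"] by (simp add: algebra_simps)
    qed simp
    have linear: "d (g + scale (int k * R) h) = d g + int k * s 0" for k
    proof (induction k)
      case (Suc k)
      have "d (g + scale (int (Suc k) * R) h) = d (g + scale (int k * R) h) + s (int k * R)"
        by (simp add: s_def e_def q_def scale_add algebra_simps)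
      thus ?case using Suc s0[of k] by (simp add: algebra_simps)
    qed simp
    have "\<bar>int k * s 0\<bar> \<le> 2 * C" for k
      using bound[of g] bound[of "g + scale (int k * R) h"] linear[of k] by linarith
    \<comment> \<open>More steps than the bound allows unless each step is zero.\<close>
    from this[of "nat (2 * C + 1)"] have "(2 * C + 1) * \<bar>s 0\<bar> \<le> 2 * C"
      using bound[of g] by (simp add: abs_mult)
    moreover have "(2 * C + 1) * 1 \<le> (2 * C + 1) * \<bar>s 0\<bar>" if "s 0 \<noteq> 0"
      using bound[of g] that by (intro mult_left_mono) auto
    ultimately have "s 0 = 0" by fastforce
    thus "e g = 0" by (simp add: s_def)
  qed
  hence "e g = 0" for g
    using top[of g] by (cases "height h g > 0") (force intro: \<open>\<And>j g. height h g = - int j \<Longrightarrow> e g = 0\<close>[of g "nat (- height h g)"])+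
  hence "d (g + scale R h) = d g" for g by (simp add: e_def q_def)
  thus thesis using that \<open>R > 0\<close> by blast
qed

text \<open>Here the half-plane has an arbitrary real normal vector \<open>n\<close>. Two exponents of \<open>\<phi>\<close> minimise the inner
  product with \<open>n\<close>, for otherwise the relation at the single minimiser \<open>u0\<close> reduces to a non-zero
  multiple of \<open>d 0\<close>. Their difference is an integer vector along the boundary, so that heights with
  respect to it are proportional to the inner product with \<open>n\<close>.\<close>

lemma real_half_plane_difference_periodic:
  fixes n :: "real \<times> real"
  assumes "\<phi> \<noteq> 0" and ann: "annihilates \<phi> d" and bound: "\<And>g. \<bar>d g\<bar> \<le> C" and n: "n \<noteq> 0"
    and van: "\<And>g. real_vec g \<bullet> n < 0 \<Longrightarrow> d g = 0" and "d 0 \<noteq> 0"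
  obtains q where "q \<noteq> 0" and "\<And>g. d (g + q) = d g" and "\<And>g. height q g > 0 \<Longrightarrow> d g = 0"
proof -
  define U where "U = Poly_Mapping.keys \<phi>"
  have U: "finite U" "U \<noteq> {}" using assms(1) by (auto simp: U_def)
  define val where "val u = real_vec u \<bullet> n" for u
  have val_diff: "val (u - v) = val u - val v" for u v
    by (simp add: val_def real_vec_def inner_prod_def algebra_simps)
  obtain u0 where u0: "u0 \<in> U" "\<And>u. u \<in> U \<Longrightarrow> val u0 \<le> val u"
    using ex_min_if_finite[of "val ` U"] U by (fastforce simp: not_less)
  have "\<exists>u1\<in>U - {u0}. val u1 = val u0"
  proof (rule ccontr)
    assume "\<not> ?thesis"
    hence "val (u0 - u) < 0" if "u \<in> U - {u0}" for u
      using that u0(2)[of u] by (force simp: val_diff less_le)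
    hence zero: "d (u0 - u) = 0" if "u \<in> U - {u0}" for u
      using van that by (simp add: val_def)
    have "(\<Sum>u\<in>U. Poly_Mapping.lookup \<phi> u * d (u0 - u)) = 0"
      using ann unfolding annihilates_def U_def by blast
    moreover have "(\<Sum>u\<in>U. Poly_Mapping.lookup \<phi> u * d (u0 - u)) = Poly_Mapping.lookup \<phi> u0 * d 0"
      using U u0(1) zero by (subst sum.remove[of U u0]) auto
    moreover have "Poly_Mapping.lookup \<phi> u0 \<noteq> 0" using u0(1) by (simp add: U_def in_keys_iff)
    ultimately show False using \<open>d 0 \<noteq> 0\<close> by simp
  qed
  then obtain u1 where u1: "u1 \<in> U" "u1 \<noteq> u0" "val u1 = val u0" by blast
  have "u1 - u0 \<noteq> 0" using u1(2) by simp
  then obtain h k where h: "h \<noteq> 0" "u1 - u0 = scale k h" "\<And>g. height h g = 0 \<Longrightarrow> \<exists>l. g = scale l h"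
    using primitive_vector[of "u1 - u0"] by metis
  have k: "k \<noteq> 0" using h(2) u1(2) by auto
  have "val (u1 - u0) = 0" using u1(3) by (simp add: val_diff)
  hence "real_of_int k * (fst h * fst n + snd h * snd n) = 0"
    by (simp add: h(2) val_def scale_def real_vec_def inner_prod_def algebra_simps)
  hence orth: "fst h * fst n + snd h * snd n = 0" using k by simp
  define N where "N = real_of_int (fst h * fst h + snd h * snd h)"
  have "N > 0"
    unfolding N_def of_int_0_less_iff using h(1) by (simp add: sum_squares_gt_zero_iff prod_eq_iff)
  define \<nu> where "\<nu> = (real_of_int (fst h) * snd n - real_of_int (snd h) * fst n) / N"
  have val_height: "val g = \<nu> * height h g" for g
  proof -
    have "N * val g = (fst h * snd n - snd h * fst n) * height h g"
      using orth unfolding N_def val_def real_vec_def height_def inner_prod_def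
      by simp algebra
    thus ?thesis using \<open>N > 0\<close> by (simp add: \<nu>_def field_simps)
  qed
  have "\<nu> \<noteq> 0"
  proof
    assume "\<nu> = 0"
    hence "val (1, 0) = 0" "val (0, 1) = 0" using val_height by simp_all
    thus False using n by (simp add: val_def real_vec_def inner_prod_def prod_eq_iff)
  qed
  \<comment> \<open>The orientation for which \<open>d\<close> vanishes above the boundary.\<close>
  define h' where "h' = (if \<nu> < 0 then h else - h)"
  have height': "height h' g = (if \<nu> < 0 then height h g else - height h g)" for g
    by (simp add: h'_def height_def)
  have h': "h' \<noteq> 0" using h(1) by (simp add: h'_def)
  have prim': "\<exists>l. g = scale l h'" if "height h' g = 0" for g
  proof -
    have "height h g = 0" using that by (auto simp: height' split: if_splits)
    then obtain l where "g = scale l h" using h(3) by blast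
    hence "g = scale (if \<nu> < 0 then l else - l) h'"
      by (simp add: h'_def scale_def prod_eq_iff)
    thus ?thesis by blast
  qed
  have van': "d g = 0" if "height h' g > 0" for g
  proof (rule van)
    show "real_vec g \<bullet> n < 0"
      using that \<open>\<nu> \<noteq> 0\<close> val_height[of g]
      by (auto simp: val_def height' mult_less_0_iff split: if_splits)
  qed
  obtain R where R: "R > 0" "\<And>g. d (g + scale R h') = d g"
    using vanishing_half_plane_periodic[OF assms(1) ann bound h' prim' van'] by blast
  show thesis
  proof (rule that)
    show "scale R h' \<noteq> 0" using R(1) h' by simp
    show "d (g + scale R h') = d g" for g by (rule R(2))
    show "d g = 0" if "height (scale R h') g > 0" for g
      using that R(1) van' by (simp add: zero_less_mult_iff)
  qed
qed

section \<open>Pairs that agree on a half-plane\<close>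

lemma norm_real_vec_add:
  "(norm (real_vec (g + h)))\<^sup>2 = (norm (real_vec g))\<^sup>2 + 2 * (real_vec g \<bullet> real_vec h) + (norm (real_vec h))\<^sup>2"
proof -
  have "real_vec (g + h) = real_vec g + real_vec h" by (simp add: real_vec_def)
  thus ?thesis by (simp add: power2_norm_eq_inner inner_add_left inner_add_right inner_commute)
qed

lemma real_vec_eq_iff [simp]: "real_vec g = real_vec h \<longleftrightarrow> g = h"
  by (simp add: real_vec_def prod_eq_iff)

lemma first_disagreement:
  fixes x y :: config
  assumes "x \<noteq> y"
  obtains g where "x g \<noteq> y g" and "\<And>h. norm (real_vec h) < norm (real_vec g) \<Longrightarrow> x h = y h"
proof -
  define m where "m g = nat (fst g * fst g + snd g * snd g)" for g :: "int \<times> int"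
  have sq: "(norm (real_vec g))\<^sup>2 = real (m g)" for g
    by (simp add: m_def real_vec_def power2_norm_eq_inner inner_prod_def)
  obtain g0 where "x g0 \<noteq> y g0" using assms by blast
  then obtain g where g: "x g \<noteq> y g" "\<And>h. x h \<noteq> y h \<Longrightarrow> m g \<le> m h"
    using ex_has_least_nat[of "\<lambda>g. x g \<noteq> y g" g0 m] by blast
  have "x h = y h" if "norm (real_vec h) < norm (real_vec g)" for h
  proof (rule ccontr)
    assume "x h \<noteq> y h"
    hence "real (m g) \<le> real (m h)" using g(2) by simp
    thus False using power_strict_mono[OF that, of 2] by (simp add: sq)
  qed
  thus thesis using that g(1) by blast
qed

text \<open>Each pair agrees inside a ball around the origin with a point of disagreement on its boundary.
  Recentred at that point, these balls have growing radii and converge, along a subsequence, to a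
  half-plane with the origin on its boundary.\<close>

lemma limit_pair_agreeing_on_half_plane:
  assumes A: "finite A" "\<And>x. x \<in> X \<Longrightarrow> range x \<subseteq> A" "\<And>x. x \<in> Y \<Longrightarrow> range x \<subseteq> A"
    and X: "closed X" "shift_invariant X" and Y: "closed Y" "shift_invariant Y"
    and pairs: "\<And>k::nat. \<exists>x\<in>X. \<exists>y\<in>Y. x \<noteq> y \<and> (\<forall>g. norm (real_vec g) \<le> real k \<longrightarrow> x g = y g)"
  obtains x y n where "x \<in> X" and "y \<in> Y" and "n \<noteq> 0" and "x 0 \<noteq> y 0"
    and "\<And>g. real_vec g \<bullet> n < 0 \<Longrightarrow> x g = y g"
proof -
  have "\<exists>x y p. x \<in> X \<and> y \<in> Y \<and> x p \<noteq> y p \<and> norm (real_vec p) > real k \<and>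
      (\<forall>h. norm (real_vec h) < norm (real_vec p) \<longrightarrow> x h = y h)" for k :: nat
  proof -
    obtain x y where xy: "x \<in> X" "y \<in> Y" "x \<noteq> y" "\<And>g. norm (real_vec g) \<le> real k \<Longrightarrow> x g = y g"
      using pairs[of k] by blast
    moreover obtain p where "x p \<noteq> y p" "\<And>h. norm (real_vec h) < norm (real_vec p) \<Longrightarrow> x h = y h"
      using first_disagreement[OF xy(3)] by blast
    ultimately show ?thesis by (meson not_le)
  qed
  then obtain f f' p where f: "\<And>k. f k \<in> X" "\<And>k. f' k \<in> Y" "\<And>k. f k (p k) \<noteq> f' k (p k)"
    "\<And>k::nat. norm (real_vec (p k)) > real k"
    "\<And>k h. norm (real_vec h) < norm (real_vec (p k)) \<Longrightarrow> f k h = f' k h"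
    by metis
  have pos: "norm (real_vec (p k)) > 0" for k using f(4)[of k] by (meson le_less_trans of_nat_0_le_iff)
  have "\<forall>k. sgn (real_vec (p k)) \<in> sphere 0 1" using pos by (auto simp: norm_sgn)
  then obtain n r where r: "n \<in> sphere 0 1" "strict_mono r" "(\<lambda>k. sgn (real_vec (p (r k)))) \<longlonglongrightarrow> n"
    using compact_sphere[of "0 :: real \<times> real" 1] unfolding compact_eq_seq_compact_metric
    by (elim seq_compactE[of _ "\<lambda>k. sgn (real_vec (p k))"]) (auto simp: comp_def)
  have "n \<noteq> 0" using r(1) by auto
  define e e' where "e k = shift (p (r k)) (f (r k))" and "e' k = shift (p (r k)) (f' (r k))" for k
  have eX: "e k \<in> X" "e' k \<in> Y" for k
    using X(2) Y(2) f(1,2) by (auto simp: e_def e'_def shift_invariant_def simp del: shift_apply)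
  obtain s x y where s: "strict_mono s" "(\<lambda>k. e (s k)) \<longlonglongrightarrow> x" "(\<lambda>k. e' (s k)) \<longlonglongrightarrow> y"
    using config_pair_subsequence[OF A(1), of e e'] eX A(2,3) by blast
  have xy: "x \<in> X" "y \<in> Y"
    using closed_sequentially[OF X(1) _ s(2)] closed_sequentially[OF Y(1) _ s(3)] eX by auto
  have ev: "\<forall>\<^sub>F k in sequentially. e (s k) g = x g \<and> e' (s k) g = y g" for g
    using s(2,3) unfolding tendsto_config_iff by (intro eventually_conj) auto
  obtain k where "e (s k) 0 = x 0" "e' (s k) 0 = y 0" using eventually_happens[OF ev[of 0]] by auto
  moreover have "e (s k) 0 \<noteq> e' (s k) 0" for k using f(3) by (simp add: e_def e'_def)
  ultimately have "x 0 \<noteq> y 0" by metis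
  have "x g = y g" if g: "real_vec g \<bullet> n < 0" for g
  proof -
    \<comment> \<open>Translating \<open>g\<close> to a far point \<open>P\<close> shortens \<open>P\<close>, since the linear term, at most
      \<open>- 2 * c * norm P\<close>, outweighs the square of \<open>norm g\<close>.\<close>
    define c where "c = - (real_vec g \<bullet> n) / 2"
    have "c > 0" using g by (simp add: c_def)
    have "(\<lambda>k. real_vec g \<bullet> sgn (real_vec (p (r (s k))))) \<longlonglongrightarrow> real_vec g \<bullet> n"
      using LIMSEQ_subseq_LIMSEQ[OF r(3) s(1)] by (intro tendsto_inner tendsto_const) (simp add: comp_def)
    moreover have "real_vec g \<bullet> n < - c" using g by (simp add: c_def)
    ultimately have "\<forall>\<^sub>F k in sequentially. real_vec g \<bullet> sgn (real_vec (p (r (s k)))) < - c"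
      by (rule order_tendstoD)
    moreover obtain K :: nat where K: "(norm (real_vec g))\<^sup>2 < real K * (2 * c)"
      using \<open>c > 0\<close> reals_Archimedean3[of "2 * c"] by auto
    have "\<forall>\<^sub>F k in sequentially. k \<ge> K" by (rule eventually_ge_at_top)
    ultimately have "\<forall>\<^sub>F k in sequentially. x g = y g"
      using ev[of g]
    proof eventually_elim
      case (elim k)
      define P where "P = real_vec (p (r (s k)))"
      have "k \<le> r (s k)" using seq_suble[OF r(2), of "s k"] seq_suble[OF s(1), of k] by linarith
      hence "real K < norm P" using elim(2) f(4)[of "r (s k)"] unfolding P_def by linarith
      have "P = norm P *\<^sub>R sgn P" using pos[of "r (s k)"] by (simp add: P_def sgn_div_norm)
      hence "real_vec g \<bullet> P = norm P * (real_vec g \<bullet> sgn P)" by (metis inner_scaleR_right)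
      also have "\<dots> \<le> norm P * (- c)" using elim(1) by (intro mult_left_mono) (auto simp: P_def)
      finally have "2 * (real_vec g \<bullet> P) \<le> - (norm P * (2 * c))" by (simp add: mult.commute)
      moreover have "real K * (2 * c) < norm P * (2 * c)" using \<open>real K < norm P\<close> \<open>c > 0\<close> by simp
      ultimately have "(norm (real_vec (g + p (r (s k)))))\<^sup>2 < (norm P)\<^sup>2"
        using K unfolding norm_real_vec_add P_def by linarith
      hence "norm (real_vec (g + p (r (s k)))) < norm P" by (rule power_less_imp_less_base) simp
      hence "e (s k) g = e' (s k) g" unfolding e_def e'_def shift_apply P_def by (rule f(5))
      thus ?case using elim(3) by simp
    qed
    thus ?thesis by simp
  qed
  thus thesis using that xy \<open>n \<noteq> 0\<close> \<open>x 0 \<noteq> y 0\<close> by blast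
qed

section \<open>Determination of a half-plane by a strip\<close>

definition determined_from_below :: "int \<times> int \<Rightarrow> config set \<Rightarrow> bool" where
  "determined_from_below q X \<longleftrightarrow>
    (\<forall>x\<in>X. \<forall>y\<in>X. (\<forall>g. height q g \<le> 0 \<longrightarrow> x g = y g) \<longrightarrow> x = y)"

definition determined_by_strips :: "int \<times> int \<Rightarrow> int \<Rightarrow> config set \<Rightarrow> bool" where
  "determined_by_strips q w X \<longleftrightarrow>
    (\<forall>x\<in>X. \<forall>y\<in>X. \<forall>j. (\<forall>g. j \<le> height q g \<and> height q g < j + w \<longrightarrow> x g = y g) \<longrightarrow>
       (\<forall>g. j \<le> height q g \<longrightarrow> x g = y g))"

text \<open>If no width suffices, pairs that agree on wider and wider strips below the origin but differ at the
  origin have a limit pair that agrees on a whole lower half-plane. So some strip determines the next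
  line above it, and by induction everything above.\<close>

lemma strip_determines_half_plane:
  assumes A: "finite A" "\<And>x. x \<in> X \<Longrightarrow> range x \<subseteq> A" and X: "closed X" "shift_invariant X" and "q \<noteq> 0"
    and det: "determined_from_below q X"
  obtains w where "determined_by_strips q w X"
proof -
  have "\<exists>w::nat. \<forall>x\<in>X. \<forall>y\<in>X. (\<forall>g. - int w \<le> height q g \<and> height q g < 0 \<longrightarrow> x g = y g) \<longrightarrow> x 0 = y 0"
  proof (rule ccontr)
    assume "\<not> ?thesis"
    hence "\<forall>w::nat. \<exists>x y. x \<in> X \<and> y \<in> X \<and> (\<forall>g. - int w \<le> height q g \<and> height q g < 0 \<longrightarrow> x g = y g) \<and> x 0 \<noteq> y 0"
      by blast
    then obtain f f' where f: "\<And>w. f w \<in> X" "\<And>w. f' w \<in> X"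
      "\<And>w g. - int w \<le> height q g \<Longrightarrow> height q g < 0 \<Longrightarrow> f w g = f' w g" "\<And>w. f w 0 \<noteq> f' w 0"
      by metis
    have "\<And>k. range (f k) \<subseteq> A" "\<And>k. range (f' k) \<subseteq> A" using f(1,2) A(2) by auto
    then obtain r x y where r: "strict_mono r" "(\<lambda>k. f (r k)) \<longlonglongrightarrow> x" "(\<lambda>k. f' (r k)) \<longlonglongrightarrow> y"
      using config_pair_subsequence[OF A(1), of f f'] by blast
    have xy: "x \<in> X" "y \<in> X"
      using closed_sequentially[OF X(1) _ r(2)] closed_sequentially[OF X(1) _ r(3)] f(1,2) by auto
    have ev: "\<forall>\<^sub>F k in sequentially. f (r k) g = x g \<and> f' (r k) g = y g" for g
      using r(2,3) unfolding tendsto_config_iff by (intro eventually_conj) auto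
    have below: "x g = y g" if "height q g < 0" for g
    proof -
      have "\<forall>\<^sub>F k in sequentially. k \<ge> nat (- height q g)" by (rule eventually_ge_at_top)
      hence "\<forall>\<^sub>F k in sequentially. x g = y g"
        using ev[of g]
      proof eventually_elim
        case (elim k)
        have "r k \<ge> k" by (rule seq_suble[OF r(1)])
        hence "f (r k) g = f' (r k) g" using elim(1) that by (intro f(3)) auto
        thus ?case using elim(2) by simp
      qed
      thus ?thesis by simp
    qed
    obtain k where "f (r k) 0 = x 0" "f' (r k) 0 = y 0"
      using eventually_happens[OF ev[of 0]] by auto
    hence "x 0 \<noteq> y 0" using f(4)[of "r k"] by simp
    obtain v where "height q v \<ge> 1" using exists_height_ge[OF \<open>q \<noteq> 0\<close>] .
    hence "\<forall>g. height q g \<le> 0 \<longrightarrow> shift (- v) x g = shift (- v) y g"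
      using below by simp
    hence "shift (- v) x = shift (- v) y"
      using det xy X(2) unfolding determined_from_below_def shift_invariant_def by blast
    from fun_cong[OF this, of v] \<open>x 0 \<noteq> y 0\<close> show False by simp
  qed
  then obtain w :: nat where w: "\<And>x y. x \<in> X \<Longrightarrow> y \<in> X \<Longrightarrow>
      (\<And>g. - int w \<le> height q g \<Longrightarrow> height q g < 0 \<Longrightarrow> x g = y g) \<Longrightarrow> x 0 = y 0"
    by blast
  have "x g = y g" if xy: "x \<in> X" "y \<in> X" and strip: "\<And>h. j \<le> height q h \<Longrightarrow> height q h < j + int w \<Longrightarrow> x h = y h"
    and g: "j \<le> height q g" for x y j g
    using g
  proof (induction "nat (height q g - j)" arbitrary: g rule: less_induct)
    case less
    show ?case
    proof (cases "height q g < j + int w")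
      case False
      have "shift g x 0 = shift g y 0"
      proof (rule w[of "shift g x" "shift g y"])
        fix h assume h: "- int w \<le> height q h" "height q h < 0"
        have "x (h + g) = y (h + g)" using False h by (intro less.hyps) auto
        thus "shift g x h = shift g y h" by simp
      qed (use xy X(2) in \<open>auto simp: shift_invariant_def\<close>)
      thus ?thesis by simp
    qed (use strip less.prems in blast)
  qed
  hence "determined_by_strips q (int w) X" unfolding determined_by_strips_def by blast
  thus thesis by (rule that)
qed

section \<open>Counting periodic differences on a strip\<close>

text \<open>In the application, \<open>a\<close> and \<open>b\<close> are the restrictions to a lower and to a higher strip; the second claim is
  the strict drop when two points merge in between.\<close>

lemma card_image_le_if_factors:
  assumes "finite (a ` Z)" and "\<And>z z'. z \<in> Z \<Longrightarrow> z' \<in> Z \<Longrightarrow> a z = a z' \<Longrightarrow> b z = b z'"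
  shows "card (b ` Z) \<le> card (a ` Z)"
    and "\<lbrakk>z \<in> Z; z' \<in> Z; a z \<noteq> a z'; b z = b z'\<rbrakk> \<Longrightarrow> card (b ` Z) < card (a ` Z)"
proof -
  define \<theta> where "\<theta> = b \<circ> inv_into Z a"
  have \<theta>: "\<theta> (a z) = b z" if "z \<in> Z" for z
    unfolding \<theta>_def comp_def using that by (intro assms(2)) (auto intro: inv_into_into f_inv_into_f)
  hence eq: "b ` Z = \<theta> ` a ` Z" by (force simp: image_image)
  show le: "card (b ` Z) \<le> card (a ` Z)" unfolding eq by (rule card_image_le[OF assms(1)])
  show "card (b ` Z) < card (a ` Z)" if "z \<in> Z" "z' \<in> Z" "a z \<noteq> a z'" "b z = b z'"
  proof (rule ccontr)
    assume "\<not> ?thesis"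
    hence "card (\<theta> ` a ` Z) = card (a ` Z)" using le unfolding eq by simp
    hence "inj_on \<theta> (a ` Z)" by (rule eq_card_imp_inj_on[OF assms(1)])
    thus False using that \<theta> by (metis imageI inj_onD)
  qed
qed

definition periodic_partners :: "config set \<Rightarrow> int \<times> int \<Rightarrow> config \<Rightarrow> config set" where
  "periodic_partners X q y = {z \<in> X. \<forall>g. z (g + q) - y (g + q) = z g - y g}"

text \<open>Recording the differences rather than the \<open>z\<close> themselves makes these sets comparable for different \<open>y\<close>.
  The set \<open>F\<close> is meant to be a fundamental domain of a strip modulo \<open>q\<close>.\<close>

definition periodic_differences :: "config set \<Rightarrow> int \<times> int \<Rightarrow> (int \<times> int) set \<Rightarrow> config \<Rightarrow> config set" where
  "periodic_differences X q F y = (\<lambda>z. restrict (\<lambda>g. z g - y g) F) ` periodic_partners X q y"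

text \<open>Shifting \<open>y\<close> amounts to reading the same partners on a translated domain. So the partners can be kept
  fixed while the strip moves.\<close>

lemma periodic_differences_shift:
  assumes "shift_invariant X"
  shows "periodic_differences X q F (shift v y) =
    (\<lambda>z. restrict (\<lambda>g. z (g + v) - y (g + v)) F) ` periodic_partners X q y"
proof -
  have partners: "periodic_partners X q (shift v y) = shift v ` periodic_partners X q y"
  proof (intro equalityI subsetI)
    fix z assume z: "z \<in> periodic_partners X q (shift v y)"
    have "shift (- v) z (g + q) - y (g + q) = shift (- v) z g - y g" for g
      using z[unfolded periodic_partners_def, simplified, THEN conjunct2, rule_format, of "g - v"]
      by (simp add: algebra_simps)
    hence "shift (- v) z \<in> periodic_partners X q y"
      using z assms by (auto simp: periodic_partners_def shift_invariant_def)
    moreover have "z = shift v (shift (- v) z)" by simp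
    ultimately show "z \<in> shift v ` periodic_partners X q y" by blast
  next
    fix z assume "z \<in> shift v ` periodic_partners X q y"
    then obtain z' where z': "z = shift v z'" "z' \<in> periodic_partners X q y" by blast
    have "z (g + q) - shift v y (g + q) = z g - shift v y g" for g
      using z'(2)[unfolded periodic_partners_def, simplified, THEN conjunct2, rule_format, of "g + v"]
      by (simp add: z'(1) algebra_simps)
    thus "z \<in> periodic_partners X q (shift v y)"
      using z' assms by (auto simp: periodic_partners_def shift_invariant_def)
  qed
  show ?thesis unfolding periodic_differences_def partners by (simp add: image_image)
qed

lemma periodic_differences_bounded:
  assumes "\<And>x. x \<in> X \<Longrightarrow> range x \<subseteq> A" and "range y \<subseteq> A"
  shows "periodic_differences X q F y \<subseteq> F \<rightarrow>\<^sub>E (\<lambda>(a, b). a - b) ` (A \<times> A)"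
proof -
  have "restrict (\<lambda>g. z g - y g) F \<in> F \<rightarrow>\<^sub>E (\<lambda>(a, b). a - b) ` (A \<times> A)" if "z \<in> X" for z
    unfolding restrict_PiE_iff
  proof
    fix g show "z g - y g \<in> (\<lambda>(a, b). a - b) ` (A \<times> A)"
      using assms(1)[OF that] assms(2) by (intro image_eqI[of _ _ "(z g, y g)"]) auto
  qed
  thus ?thesis unfolding periodic_differences_def periodic_partners_def by blast
qed

text \<open>A difference that occurs for infinitely many \<open>f k\<close> occurs in the limit: the partners that realise it
  have a convergent subsequence. As there are finitely many possible differences, those
  which do not occur for \<open>y\<close> are eventually all absent.\<close>

lemma periodic_differences_upper_semicontinuous:
  assumes A: "finite A" "\<And>x. x \<in> X \<Longrightarrow> range x \<subseteq> A" and X: "closed X" and "finite F"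
    and f: "\<And>k. f k \<in> X" "f \<longlonglongrightarrow> y"
  shows "\<forall>\<^sub>F k in sequentially. periodic_differences X q F (f k) \<subseteq> periodic_differences X q F y"
proof -
  define \<Delta> where "\<Delta> = F \<rightarrow>\<^sub>E (\<lambda>(a, b). a - b) ` (A \<times> A)"
  have "finite \<Delta>" unfolding \<Delta>_def using A(1) \<open>finite F\<close> by (intro finite_PiE) auto
  have sub: "periodic_differences X q F (f k) \<subseteq> \<Delta>" for k
    unfolding \<Delta>_def using A(2) f(1) by (intro periodic_differences_bounded) auto
  have "\<forall>\<^sub>F k in sequentially. \<delta> \<notin> periodic_differences X q F (f k)"
    if \<delta>: "\<delta> \<notin> periodic_differences X q F y" for \<delta>
  proof (rule ccontr)
    assume "\<not> ?thesis"
    hence "\<exists>\<^sub>F k in sequentially. \<delta> \<in> periodic_differences X q F (f k)"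
      by (simp add: frequently_def)
    hence "infinite {k. \<delta> \<in> periodic_differences X q F (f k)}"
      by (simp add: frequently_sequentially infinite_nat_iff_unbounded_le)
    then obtain r where r: "strict_mono (r :: nat \<Rightarrow> nat)" "\<And>k. \<delta> \<in> periodic_differences X q F (f (r k))"
      using infinite_enumerate[of "{k. \<delta> \<in> periodic_differences X q F (f k)}"] by auto
    have "\<exists>z. \<forall>k. z k \<in> periodic_partners X q (f (r k)) \<and> \<delta> = restrict (\<lambda>g. z k g - f (r k) g) F"
      using r(2) unfolding periodic_differences_def by (intro choice allI) blast
    then obtain z where z: "\<And>k. z k \<in> periodic_partners X q (f (r k))"
      "\<And>k. \<delta> = restrict (\<lambda>g. z k g - f (r k) g) F"
      by blast
    have zX: "z k \<in> X" for k using z(1)[of k] by (simp add: periodic_partners_def)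
    then obtain s z' where s: "strict_mono s" "(\<lambda>k. z (s k)) \<longlonglongrightarrow> z'"
      using config_subsequence[OF A(1), of z] A(2) by blast
    have "(\<lambda>k. f (r (s k))) \<longlonglongrightarrow> y"
      using LIMSEQ_subseq_LIMSEQ[OF f(2) strict_mono_o[OF r(1) s(1)]] by (simp add: comp_def)
    hence ev: "\<forall>\<^sub>F k in sequentially. z (s k) g = z' g \<and> f (r (s k)) g = y g" for g
      using s(2) unfolding tendsto_config_iff by (intro eventually_conj) auto
    have "z' (g + q) - y (g + q) = z' g - y g" for g
    proof -
      have "\<forall>\<^sub>F k in sequentially. z' (g + q) - y (g + q) = z' g - y g"
        using ev[of g] ev[of "g + q"]
      proof eventually_elim
        case (elim k)
        have "z (s k) (g + q) - f (r (s k)) (g + q) = z (s k) g - f (r (s k)) g"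
          using z(1)[of "s k"] by (simp add: periodic_partners_def)
        thus ?case by (simp only: elim)
      qed
      thus ?thesis by simp
    qed
    moreover have "z' \<in> X" using closed_sequentially[OF X _ s(2)] zX by blast
    ultimately have "z' \<in> periodic_partners X q y" by (simp add: periodic_partners_def)
    moreover have "\<delta> = restrict (\<lambda>g. z' g - y g) F"
    proof
      fix g
      have "\<forall>\<^sub>F k in sequentially. \<delta> g = restrict (\<lambda>g. z' g - y g) F g"
        using ev[of g]
      proof eventually_elim
        case (elim k)
        have "\<delta> g = restrict (\<lambda>g. z (s k) g - f (r (s k)) g) F g"
          by (rule fun_cong[OF z(2)])
        thus ?case unfolding restrict_def by (simp only: elim)
      qed
      thus "\<delta> g = restrict (\<lambda>g. z' g - y g) F g" by simp
    qed
    ultimately show False using \<delta> by (auto simp: periodic_differences_def)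
  qed
  hence "\<forall>\<^sub>F k in sequentially. \<forall>\<delta>\<in>\<Delta> - periodic_differences X q F y. \<delta> \<notin> periodic_differences X q F (f k)"
    using \<open>finite \<Delta>\<close> by (intro eventually_ball_finite) auto
  thus ?thesis by eventually_elim (use sub in blast)
qed

text \<open>The number of periodic differences of the translates of \<open>y\<close> does not increase upwards, and it is
  strictly larger below the merging of \<open>x\<close> and \<open>y\<close> than at height zero. Since translates from far below converge
  to \<open>y\<close>, semicontinuity gives the opposite inequality.\<close>

lemma recurrent_no_periodic_merging:
  assumes A: "finite A" "\<And>x. x \<in> X \<Longrightarrow> range x \<subseteq> A" and X: "closed X" "shift_invariant X" and "q \<noteq> 0"
    and det: "determined_from_below q X"
    and xy: "x \<in> X" "y \<in> X" and per: "\<And>g. x (g + q) - y (g + q) = x g - y g"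
    and agree: "\<And>g. height q g \<ge> 0 \<Longrightarrow> x g = y g"
    and rec: "\<And>c. \<exists>v. (\<forall>k. height q (v k) \<le> c) \<and> (\<lambda>k. shift (v k) y) \<longlonglongrightarrow> y"
  shows "x = y"
proof (rule ccontr)
  assume "x \<noteq> y"
  then obtain g0 where g0: "x g0 \<noteq> y g0" by blast
  hence neg: "height q g0 < 0" using agree[of g0] by fastforce
  obtain w where w: "determined_by_strips q w X"
    using strip_determines_half_plane[OF A X \<open>q \<noteq> 0\<close> det] by blast
  have strip: "x g = y g" if "x \<in> X" "y \<in> X" "j \<le> height q g"
    "\<And>h. j \<le> height q h \<Longrightarrow> height q h < j + w \<Longrightarrow> x h = y h" for x y j g
    using w that unfolding determined_by_strips_def by blast
  obtain F where F: "finite F" "\<And>g. g \<in> F \<Longrightarrow> 0 \<le> height q g"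
    "\<And>g. 0 \<le> height q g \<Longrightarrow> height q g < w \<Longrightarrow> \<exists>k. g + scale k q \<in> F"
    using strip_fundamental_domain[OF \<open>q \<noteq> 0\<close>, of w] by metis
  define Z where "Z = periodic_partners X q y"
  define a where "a v z = restrict (\<lambda>g. z (g + v) - y (g + v)) F" for v and z :: config
  have D: "periodic_differences X q F (shift v y) = a v ` Z" for v
    unfolding a_def Z_def by (rule periodic_differences_shift[OF X(2)])
  have shiftX: "shift v z \<in> X" if "z \<in> X" for v z using X(2) that by (simp add: shift_invariant_def)
  have ZX: "z \<in> X" if "z \<in> Z" for z using that by (simp add: Z_def periodic_partners_def)
  have above: "z g = z' g" if z: "z \<in> Z" "z' \<in> Z" "a v z = a v z'" and g: "height q g \<ge> height q v" for z z' v g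
  proof -
    have pq: "z (g + q) - z' (g + q) = z g - z' g" for g
    proof -
      have "z (g + q) - y (g + q) = z g - y g" "z' (g + q) - y (g + q) = z' g - y g"
        using z(1,2) unfolding Z_def periodic_partners_def by blast+
      thus ?thesis by linarith
    qed
    have pz: "z (g + scale k q) - z' (g + scale k q) = z g - z' g" for g k
      using periodic_scale[of "\<lambda>g. z g - z' g", OF pq] .
    have "shift v z h = shift v z' h" if h: "0 \<le> height q h" "height q h < w" for h
    proof -
      obtain k where k: "h + scale k q \<in> F" using F(3)[OF h] by blast
      hence "z (h + scale k q + v) = z' (h + scale k q + v)"
        using fun_cong[OF z(3), of "h + scale k q"] by (simp add: a_def)
      thus ?thesis using pz[of "h + v" k] by (simp add: algebra_simps)
    qed
    moreover have "shift v z \<in> X" "shift v z' \<in> X" using z ZX shiftX by auto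
    moreover have "0 \<le> height q (g - v)" using g by simp
    ultimately have "shift v z (g - v) = shift v z' (g - v)"
      by (intro strip[of "shift v z" "shift v z'" 0 "g - v"]) simp_all
    thus ?thesis by simp
  qed
  have fin: "finite (a v ` Z)" for v
  proof -
    have "range (shift v y) \<subseteq> A" using A(2) shiftX xy(2) by blast
    moreover have "finite (F \<rightarrow>\<^sub>E (\<lambda>(a, b). a - b) ` (A \<times> A))"
      using A(1) F(1) by (intro finite_PiE) auto
    moreover have "a v ` Z \<subseteq> F \<rightarrow>\<^sub>E (\<lambda>(a, b). a - b) ` (A \<times> A)"
      unfolding D[symmetric] using A(2) \<open>range (shift v y) \<subseteq> A\<close> by (rule periodic_differences_bounded)
    ultimately show ?thesis by (meson finite_subset)
  qed
  have factors: "a v' z = a v' z'" if "z \<in> Z" "z' \<in> Z" "a v z = a v z'" "height q v \<le> height q v'" for z z' v v'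
  proof
    fix g
    show "a v' z g = a v' z' g"
      using above[OF that(1-3), of "g + v'"] F(2)[of g] that(4) by (auto simp: a_def restrict_def)
  qed
  have xyZ: "x \<in> Z" "y \<in> Z" using xy per by (auto simp: Z_def periodic_partners_def)
  have "a 0 x = a 0 y" using agree F(2) by (auto simp: a_def restrict_def)
  have less: "card (a 0 ` Z) < card (a v ` Z)" if v: "height q v \<le> height q g0" for v
  proof (rule card_image_le_if_factors(2)[where a = "a v" and b = "a 0" and z = x and z' = y])
    show "finite (a v ` Z)" by (rule fin)
    show "x \<in> Z" "y \<in> Z" "a 0 x = a 0 y" by fact+
    show "a 0 z = a 0 z'" if "z \<in> Z" "z' \<in> Z" "a v z = a v z'" for z z'
      using factors[OF that] v neg by simp
    show "a v x \<noteq> a v y" using above[OF xyZ _ v] g0 by blast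
  qed
  obtain v where v: "\<And>k. height q (v k) \<le> height q g0" "(\<lambda>k. shift (v k) y) \<longlonglongrightarrow> y"
    using rec by blast
  have "\<forall>\<^sub>F k in sequentially. periodic_differences X q F (shift (v k) y) \<subseteq> periodic_differences X q F y"
    using A X(1) F(1) shiftX[OF xy(2)] v(2) by (rule periodic_differences_upper_semicontinuous)
  then obtain k where "periodic_differences X q F (shift (v k) y) \<subseteq> periodic_differences X q F (shift 0 y)"
    by (auto dest: eventually_happens)
  hence "card (a (v k) ` Z) \<le> card (a 0 ` Z)"
    unfolding D by (rule card_mono[OF fin])
  thus False using less[OF v(1)[of k]] by simp
qed

section \<open>Rigidity of minimal subshifts and the theorem\<close>

text \<open>A failure for all radii produces a limit pair with a periodic difference. The pair itself
  excludes one of the two alternatives in the hypothesis on half-planes, and the other one contradicts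
  the recurrence of minimal points.\<close>

lemma minimal_agreement_radius:
  assumes "finite A" and XA: "\<And>x. x \<in> X \<Longrightarrow> range x \<subseteq> A" and X: "closed X" "shift_invariant X"
    and "\<phi> \<noteq> 0" and ann: "\<And>x. x \<in> X \<Longrightarrow> annihilates \<phi> x"
    and sides: "\<And>q. q \<noteq> 0 \<Longrightarrow> determined_from_below q X \<or> determined_from_below (- q) X"
    and M: "minimal_subshift M" "M \<subseteq> X"
  obtains k :: nat where "\<And>x y. x \<in> X \<Longrightarrow> y \<in> M \<Longrightarrow>
      (\<And>g. norm (real_vec g) \<le> real k \<Longrightarrow> x g = y g) \<Longrightarrow> x = y"
proof -
  have M': "closed M" "shift_invariant M" using M(1) by (auto simp: minimal_subshift_def)
  have MA: "range x \<subseteq> A" if "x \<in> M" for x using XA M(2) that by blast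
  have "compact M"
    using compact_Int_closed[OF compact_alphabet[OF assms(1)] M'(1)] MA
    by (simp add: Int_absorb1 subset_iff)
  have "\<not> (\<forall>k::nat. \<exists>x\<in>X. \<exists>y\<in>M. x \<noteq> y \<and> (\<forall>g. norm (real_vec g) \<le> real k \<longrightarrow> x g = y g))"
  proof
    assume pairs: "\<forall>k::nat. \<exists>x\<in>X. \<exists>y\<in>M. x \<noteq> y \<and> (\<forall>g. norm (real_vec g) \<le> real k \<longrightarrow> x g = y g)"
    obtain x y n where xy: "x \<in> X" "y \<in> M" "n \<noteq> 0" "x 0 \<noteq> y 0"
      and half: "\<And>g. real_vec g \<bullet> n < 0 \<Longrightarrow> x g = y g"
      using limit_pair_agreeing_on_half_plane[OF assms(1) XA MA X M' pairs[rule_format]] by metis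
    define d where "d g = x g - y g" for g
    define C where "C = Max (abs ` A)"
    have "annihilates \<phi> d"
      using annihilates_shift_diff[OF ann ann, of x y 0] xy M(2) by (auto simp: d_def[abs_def])
    moreover have C: "\<bar>a\<bar> \<le> C" if "a \<in> A" for a
      unfolding C_def using assms(1) that by (intro Max_ge) auto
    have "\<bar>d g\<bar> \<le> 2 * C" for g
    proof -
      have "x g \<in> A" "y g \<in> A" using XA xy(1,2) M(2) by blast+
      thus ?thesis using C[of "x g"] C[of "y g"] by (simp add: d_def)
    qed
    moreover have "d g = 0" if "real_vec g \<bullet> n < 0" for g using half[OF that] by (simp add: d_def)
    moreover have "d 0 \<noteq> 0" using xy(4) by (simp add: d_def)
    ultimately obtain q where q: "q \<noteq> 0" "\<And>g. d (g + q) = d g" "\<And>g. height q g > 0 \<Longrightarrow> d g = 0"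
      using real_half_plane_difference_periodic[OF \<open>\<phi> \<noteq> 0\<close> _ _ xy(3), of d "2 * C"] by metis
    \<comment> \<open>Shift the pair so that it agrees on the closed half-plane and not only on the open one.\<close>
    obtain u where u: "height q u \<ge> 1" using exists_height_ge[OF q(1)] .
    define x' y' where "x' = shift u x" and "y' = shift u y"
    have x'y': "x' \<in> X" "y' \<in> M" "y' \<in> X"
      using xy X(2) M(2) M'(2) by (auto simp: x'_def y'_def shift_invariant_def simp del: shift_apply)
    have agree: "x' g = y' g" if "height q g \<ge> 0" for g
      using q(3)[of "g + u"] that u by (simp add: x'_def y'_def d_def)
    have ne: "x' \<noteq> y'"
    proof
      assume "x' = y'"
      from fun_cong[OF this, of "- u"] show False using xy(4) by (simp add: x'_def y'_def)
    qed
    have "\<not> determined_from_below (- q) X"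
    proof
      assume "determined_from_below (- q) X"
      moreover have "height (- q) g = - height q g" for g by (simp add: height_def)
      ultimately show False
        using x'y' agree ne unfolding determined_from_below_def by auto
    qed
    hence "determined_from_below q X"
      using sides[OF q(1)] by blast
    moreover have "x' (g + q) - y' (g + q) = x' g - y' g" for g
      using q(2)[of "g + u"] by (simp add: x'_def y'_def d_def ac_simps)
    moreover have "\<exists>v. (\<forall>k. height q (v k) \<le> c) \<and> (\<lambda>k. shift (v k) y') \<longlonglongrightarrow> y'" for c
      using minimal_recurrent_downward[OF M(1) \<open>compact M\<close> q(1) x'y'(2), of c] by blast
    ultimately have "x' = y'"
      using recurrent_no_periodic_merging[OF assms(1) XA X q(1) _ x'y'(1,3)] agree by blast
    thus False using ne by blast
  qed
  thus thesis using that by blast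
qed

lemma uminus_oriented: "uminus ` oriented u = oriented (- u)"
  unfolding oriented_def setcompr_eq_image image_image by simp

lemma half_plane_oriented_real_vec: "half_plane (oriented (real_vec q)) = {g. height q g \<ge> 0}"
proof -
  have "real_vec g \<bullet> (- snd (real_vec q), fst (real_vec q)) = real_of_int (height q g)" for g
    by (simp add: real_vec_def height_def inner_prod_def)
  thus ?thesis by (simp add: half_plane_oriented)
qed

text \<open>For a line with an integer direction vector, heights describe the half-planes of both orientations.\<close>

lemma oriented_line_cases:
  assumes "\<And>l L. line_through_origin l \<Longrightarrow> L \<in> orientations l \<Longrightarrow> L \<notin> ONED \<eta> \<or> uminus ` L \<notin> ONED \<eta>"
    and "q \<noteq> 0"
  shows "determined_from_below q (orbit_closure \<eta>) \<or> determined_from_below (- q) (orbit_closure \<eta>)"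
proof -
  define u where "u = real_vec q"
  have u: "u \<noteq> 0" using assms(2) real_vec_eq_iff[of q 0] by (simp add: u_def real_vec_def zero_prod_def)
  have "line_through_origin (span {u})"
    unfolding line_through_origin_def using u by (simp add: dim_span dim_singleton)
  moreover have "oriented u \<in> orientations (span {u})" using orientations_span[OF u] by simp
  ultimately have "oriented u \<notin> ONED \<eta> \<or> oriented (- u) \<notin> ONED \<eta>"
    using assms(1) by (metis uminus_oriented)
  moreover have "oriented v \<in> oriented_lines" if "v \<noteq> 0" for v
    using that by (auto simp: oriented_lines_def)
  ultimately have exp: "one_sided_expansive \<eta> (oriented u) \<or> one_sided_expansive \<eta> (oriented (- u))"
    using u by (auto simp: ONED_def)
  have minus: "- u = real_vec (- q)" by (simp add: u_def real_vec_def)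
  have height: "height (- q) g = - height q g" for g by (simp add: height_def)
  show ?thesis
    using exp unfolding one_sided_expansive_def minus
    unfolding u_def half_plane_oriented_real_vec determined_from_below_def mem_Collect_eq height by auto
qed

lemma finite_invariant_fully_periodic:
  assumes "finite M" and "shift_invariant M" and "\<eta> \<in> M"
  shows "fully_periodic \<eta>"
proof -
  have period: "\<exists>k>0. is_period \<eta> (scale k u)" if "u \<noteq> 0" for u
  proof -
    have "(\<lambda>i. shift (scale (int i) u) \<eta>) ` UNIV \<subseteq> M"
      using assms(2,3) by (auto simp: shift_invariant_def simp del: shift_apply)
    hence "finite (range (\<lambda>i. shift (scale (int i) u) \<eta>))" using assms(1) by (rule finite_subset)
    hence "\<not> inj (\<lambda>i. shift (scale (int i) u) \<eta>)" using finite_imageD infinite_UNIV_nat by blast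
    then obtain i j where ij: "i < j" "shift (scale (int i) u) \<eta> = shift (scale (int j) u) \<eta>"
      unfolding inj_on_def by (metis linorder_neqE_nat)
    have "\<eta> (g + scale (int j - int i) u) = \<eta> g" for g
      using fun_cong[OF ij(2), of "g - scale (int i) u"] by (simp add: scale_diff algebra_simps)
    thus ?thesis using ij(1) that by (intro exI[of _ "int j - int i"]) (simp add: is_period_def)
  qed
  obtain a b where ab: "a > 0" "is_period \<eta> (scale a (1, 0))" "b > 0" "is_period \<eta> (scale b (0, 1))"
    using period[of "(1, 0)"] period[of "(0, 1)"] by (auto simp: zero_prod_def)
  have "independent {real_vec (scale a (1, 0)), real_vec (scale b (0, 1))}"
    unfolding independent_insert using ab(1,3) independent_empty
    by (auto simp: span_singleton real_vec_def scale_def zero_prod_def)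
  moreover have "scale a (1, 0) \<noteq> scale b (0, 1)" using ab(1) by (simp add: scale_def)
  ultimately show ?thesis unfolding fully_periodic_def using ab(2,4) by blast
qed

lemma finite_ball: "finite {g. norm (real_vec g) \<le> real k}"
proof (rule finite_subset)
  show "{g. norm (real_vec g) \<le> real k} \<subseteq> {- int k..int k} \<times> {- int k..int k}"
  proof
    fix g assume "g \<in> {g. norm (real_vec g) \<le> real k}"
    hence "\<bar>real_of_int (fst g)\<bar> \<le> real k" "\<bar>real_of_int (snd g)\<bar> \<le> real k"
      using norm_fst_le[of "fst (real_vec g)" "snd (real_vec g)"]
        norm_snd_le[of "snd (real_vec g)" "fst (real_vec g)"]
      by (simp_all add: real_vec_def)
    hence "\<bar>fst g\<bar> \<le> int k" "\<bar>snd g\<bar> \<le> int k" by linarith+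
    thus "g \<in> {- int k..int k} \<times> {- int k..int k}"
      unfolding mem_Times_iff by auto
  qed
qed simp

theorem theorem1p14:
  fixes A :: "int set" and \<eta> :: config
  assumes "finite A" and "card A \<ge> 2"
    and "range \<eta> \<subseteq> A"
    and "has_nontrivial_annihilator \<eta>"
    and "\<And>l L. line_through_origin l \<Longrightarrow> L \<in> orientations l \<Longrightarrow>
           L \<notin> ONED \<eta> \<or> uminus ` L \<notin> ONED \<eta>"
  shows "fully_periodic \<eta>"
proof -
  define X where "X = orbit_closure \<eta>"
  have X: "closed X" "shift_invariant X" "\<eta> \<in> X"
    by (simp_all add: X_def orbit_closure_closed orbit_closure_shift_invariant orbit_closure_self)
  have XA: "range x \<subseteq> A" if "x \<in> X" for x
    using orbit_closure_alphabet[OF assms(3)] that by (simp add: X_def)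
  have "compact X"
    using compact_Int_closed[OF compact_alphabet[OF assms(1)] X(1)] XA
    by (simp add: Int_absorb1 subset_iff)
  then obtain M where M: "minimal_subshift M" "M \<subseteq> X"
    using minimal_subshift_exists[of X] X by blast
  hence M': "closed M" "M \<noteq> {}" "shift_invariant M" by (auto simp: minimal_subshift_def)
  obtain \<phi> where \<phi>: "\<phi> \<noteq> 0" "annihilates \<phi> \<eta>"
    using assms(4) by (auto simp: has_nontrivial_annihilator_def)
  have ann: "annihilates \<phi> z" if "z \<in> X" for z
    using orbit_closure_annihilates[OF \<phi>(2)] that by (simp add: X_def)
  have sides: "determined_from_below q X \<or> determined_from_below (- q) X" if "q \<noteq> 0" for q
    unfolding X_def using assms(5) that by (rule oriented_line_cases)
  obtain k :: nat where k: "\<And>x y. x \<in> X \<Longrightarrow> y \<in> M \<Longrightarrow>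
      (\<And>g. norm (real_vec g) \<le> real k \<Longrightarrow> x g = y g) \<Longrightarrow> x = y"
    using minimal_agreement_radius[OF assms(1) XA X(1,2) \<phi>(1) ann sides M] by metis
  define B where "B = {g. norm (real_vec g) \<le> real k}"
  have "finite B" unfolding B_def by (rule finite_ball)
  have "finite M"
  proof (rule finite_imageD)
    show "finite ((\<lambda>x. restrict x B) ` M)"
    proof (rule finite_subset)
      show "(\<lambda>x. restrict x B) ` M \<subseteq> B \<rightarrow>\<^sub>E A"
      proof (rule image_subsetI)
        fix x assume "x \<in> M"
        hence "range x \<subseteq> A" using XA M(2) by blast
        thus "restrict x B \<in> B \<rightarrow>\<^sub>E A" unfolding restrict_PiE_iff by blast
      qed
      show "finite (B \<rightarrow>\<^sub>E A)" using \<open>finite B\<close> assms(1) by (intro finite_PiE) auto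
    qed
    show "inj_on (\<lambda>x. restrict x B) M"
    proof (rule inj_onI)
      fix x y assume xy: "x \<in> M" "y \<in> M" "restrict x B = restrict y B"
      have "x g = y g" if "g \<in> B" for g using fun_cong[OF xy(3), of g] that by simp
      thus "x = y" using xy(1,2) M(2) by (intro k) (auto simp: B_def)
    qed
  qed
  obtain m where m: "m \<in> M" using M'(2) by blast
  hence "m \<in> orbit_closure \<eta>" using M(2) by (auto simp: X_def)
  then obtain f where f: "\<And>i. f i \<in> range (\<lambda>u. shift u \<eta>)" "f \<longlonglongrightarrow> m"
    unfolding orbit_closure_def closure_sequential by blast
  have "\<forall>\<^sub>F i in sequentially. \<forall>g\<in>B. f i g = m g"
    using f(2) \<open>finite B\<close> by (intro eventually_ball_finite) (auto simp: tendsto_config_iff)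
  then obtain i where i: "\<forall>g\<in>B. f i g = m g" by (auto dest: eventually_happens)
  obtain u where u: "f i = shift u \<eta>" using f(1) by blast
  have "f i \<in> X" using X(2,3) by (auto simp: u shift_invariant_def simp del: shift_apply)
  hence "f i = m" using m i by (intro k) (auto simp: B_def)
  hence "shift (- u) m = \<eta>" by (metis u shift_shift shift_zero add.left_inverse)
  hence "\<eta> \<in> M" using m M'(3) unfolding shift_invariant_def by metis
  thus ?thesis using finite_invariant_fully_periodic \<open>finite M\<close> M'(3) by blast
qed

end
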